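(* Let $b>-1$ and assume that the radius distribution satisfies $f(r)=\min\{\frac{\ln^{b}(r)}{r},1\}$. Then the sequence $(f(n)\tau_n)_n$ is tight. Moreover, for every subsequence $(n_k)_k$ such that $f(n_k)T_{n_k}\Longrightarrow Y$ in distribution, the limit $Y$ (which may depend on $f$ and $(n_k)_k$) is a non-degenerate distribution with compact support.
   Context: Covering process: let $R$ be a random variable with values in $\{1,2,\dots\}$ and $f(r)=\mathbb{P}(R\ge r)$ for real $r\ge 1$. For $n\ge1$ consider the discrete torus $\mathbb{Z}/n\mathbb{Z}=\{0,\dots,n-1\}$. Let $(R_k)_{k\ge1}$ be i.i.d. copies of $R$ and $(U_k)_{k\ge1}$ i.i.d. uniform on $\mathbb{Z}/n\mathbb{Z}$, independent. The $k$-th object is $\mathcal{O}_k=\{U_k,U_k+1,\dots,U_k+R_k-1\}$ (mod $n$). Set $C_0=\emptyset$, $C_k=C_{k-1}\cup\mathcal{O}_k$, and the discrete cover time $\tau_n=\min\{k: C_k=\mathbb{Z}/n\mathbb{Z}\}$. With $(N(t))_{t\ge0}$ an independent rate-one Poisson process, $X_t=C_{N(t)}$ and $T_n=\inf\{t: X_t=\mathbb{Z}/n\mathbb{Z}\}$. A distribution is non-degenerate if it is not concentrated on a single point; the support of a law $Y$ is the set of $y\in\mathbb{R}$ such that every neighbourhood of $y$ has positive probability. *)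

theory Defs
  imports "HOL-Probability.Probability"
begin

text \<open>The torus Z/nZ is represented by {0..<n}. Object placed at u with radius r.\<close>
definition cov_object :: "nat \<Rightarrow> nat \<Rightarrow> nat \<Rightarrow> nat set" where
  "cov_object n u r = {(u + i) mod n | i. i < r}"

text \<open>One step of randomness: (radius, position, exponential inter-arrival time
  of the rate-one Poisson process).\<close>
definition step_space :: "nat pmf \<Rightarrow> nat \<Rightarrow> (nat \<times> nat \<times> real) measure" where
  "step_space Rd n = measure_pmf Rd \<Otimes>\<^sub>M (measure_pmf (pmf_of_set {0..<n})
      \<Otimes>\<^sub>M density lborel (exponential_density 1))"

text \<open>Underlying probability space: i.i.d. sequence of steps (index j = object j+1).\<close>
definition cov_space :: "nat pmf \<Rightarrow> nat \<Rightarrow> (nat \<times> nat \<times> real) stream measure" where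
  "cov_space Rd n = stream_space (step_space Rd n)"

definition covered :: "nat \<Rightarrow> (nat \<times> nat \<times> real) stream \<Rightarrow> nat \<Rightarrow> nat set" where
  "covered n \<omega> k = (\<Union>j<k. cov_object n (fst (snd (snth \<omega> j))) (fst (snth \<omega> j)))"

definition cover_time :: "nat \<Rightarrow> (nat \<times> nat \<times> real) stream \<Rightarrow> nat" where
  "cover_time n \<omega> = (LEAST k. covered n \<omega> k = {0..<n})"

definition arrival :: "(nat \<times> nat \<times> real) stream \<Rightarrow> nat \<Rightarrow> real" where
  "arrival \<omega> k = (\<Sum>j<k. snd (snd (snth \<omega> j)))"

text \<open>Continuous cover time T_n = inf{t. X_t = Z/nZ} = arrival time of the tau_n-th event.\<close>
definition cont_cover_time :: "nat \<Rightarrow> (nat \<times> nat \<times> real) stream \<Rightarrow> real" where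
  "cont_cover_time n \<omega> = arrival \<omega> (cover_time n \<omega>)"

definition tailf :: "nat pmf \<Rightarrow> nat \<Rightarrow> real" where
  "tailf Rd r = measure_pmf.prob Rd {r..}"

definition nondegenerate :: "real measure \<Rightarrow> bool" where
  "nondegenerate Y \<longleftrightarrow> \<not> (\<exists>c. measure Y {c} = 1)"

definition support_of :: "real measure \<Rightarrow> real set" where
  "support_of Y = {y. \<forall>e>0. measure Y (ball y e) > 0}"

end

theory Submission
  imports Defs "HOL-Real_Asymp.Real_Asymp"
begin

text \<open>
  Write \<open>f\<close> for \<open>tailf Rd\<close> and \<open>F n d\<close> for the sum of \<open>f r\<close> over \<open>d < r \<le> n\<close> (\<open>tail_sum Rd n d\<close>). One object
  hits a given point with probability \<open>p = F n 0 / n\<close>, of order \<open>f n * ln n\<close>, so after \<open>M / f n\<close>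
  objects the expected number of uncovered points is at most \<open>n * exp (- c * M * ln n)\<close>. For large \<open>M\<close> this
  vanishes: this gives tightness and an upper bound for the support. A single object with \<open>R \<ge> n\<close> covers
  everything, and such an object arrives before time \<open>t / f n\<close> with probability bounded below, for every
  \<open>t > 0\<close>; hence a degenerate limit could only sit at \<open>0\<close>.

  This is excluded by a second moment argument at \<open>k = \<epsilon> / f n\<close> objects. Two points at cyclic distance \<open>d\<close> are
  hit by the same object with probability at most \<open>(F n d + F n (n - d)) / n\<close>, and \<open>b > -1\<close> enters
  through \<open>F n d \<le> K * n * f n * ln ((n + 2) / (d + 2))\<close>. For small \<open>\<epsilon>\<close> the ratio of the joint probability of being
  uncovered to the product is therefore at most the mean of \<open>sqrt ((n + 2) / (d + 2))\<close> and
  \<open>sqrt ((n + 2) / (n - d + 2))\<close>, whose average over \<open>d\<close> is bounded. By Paley--Zygmund some point is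
  uncovered with probability at least \<open>1 / 6\<close>. Exponential Chernoff bounds for the arrival times transfer everything
  to continuous time.
\<close>

section \<open>Independent steps\<close>

text \<open>Independence of the coordinates, by splitting off the head of the stream. It is applied
  to indicators, which give the probability that \<open>k\<close> steps all avoid an event, and to
  exponentials, which give the moment generating function of an arrival time.\<close>

lemma (in prob_space) nn_integral_stream_prod:
  fixes g :: "'a \<Rightarrow> ennreal"
  assumes [measurable]: "g \<in> borel_measurable M"
  shows "(\<integral>\<^sup>+\<omega>. (\<Prod>j<k. g (\<omega> !! j)) \<partial>stream_space M) = (\<integral>\<^sup>+x. g x \<partial>M) ^ k"
proof (induction k)
  case 0
  interpret S: prob_space "stream_space M" by (rule prob_space_stream_space)
  show ?case by (simp add: S.emeasure_space_1)
next
  case (Suc k)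
  have "(\<integral>\<^sup>+\<omega>. (\<Prod>j<Suc k. g (\<omega> !! j)) \<partial>stream_space M)
      = (\<integral>\<^sup>+x. \<integral>\<^sup>+\<omega>. (\<Prod>j<Suc k. g ((x ## \<omega>) !! j)) \<partial>stream_space M \<partial>M)"
    by (rule nn_integral_stream_space) measurable
  also have "\<dots> = (\<integral>\<^sup>+x. g x * (\<integral>\<^sup>+\<omega>. (\<Prod>j<k. g (\<omega> !! j)) \<partial>stream_space M) \<partial>M)"
    by (simp add: prod.lessThan_Suc_shift nn_integral_cmult del: prod.lessThan_Suc)
  also have "\<dots> = (\<integral>\<^sup>+x. g x \<partial>M) ^ Suc k"
    by (simp add: Suc.IH nn_integral_multc)
  finally show ?case .
qed

text \<open>The indicator of the event is the product of the indicators of the \<open>k\<close>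
  coordinates.\<close>

lemma (in prob_space) prob_stream_all_less:
  assumes [measurable]: "Measurable.pred M P"
  shows "measure (stream_space M) {\<omega> \<in> space (stream_space M). \<forall>j<k. P (\<omega> !! j)}
       = measure M {x \<in> space M. P x} ^ k"
proof -
  interpret S: prob_space "stream_space M" by (rule prob_space_stream_space)
  have [measurable]: "{x \<in> space M. P x} \<in> sets M" by measurable
  have "emeasure (stream_space M) {\<omega> \<in> space (stream_space M). \<forall>j<k. P (\<omega> !! j)}
      = (\<integral>\<^sup>+\<omega>. indicator {\<omega> \<in> space (stream_space M). \<forall>j<k. P (\<omega> !! j)} \<omega> \<partial>stream_space M)"
    by (subst nn_integral_indicator) simp_all
  also have "\<dots> = (\<integral>\<^sup>+\<omega>. (\<Prod>j<k. indicator {x \<in> space M. P x} (\<omega> !! j)) \<partial>stream_space M)"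
  proof (rule nn_integral_cong)
    fix \<omega> assume \<omega>: "\<omega> \<in> space (stream_space M)"
    then have sp: "\<omega> !! j \<in> space M" for j
      by (simp add: space_stream_space snth_in)
    show "indicator {\<omega> \<in> space (stream_space M). \<forall>j<k. P (\<omega> !! j)} \<omega>
        = (\<Prod>j<k. indicator {x \<in> space M. P x} (\<omega> !! j) :: ennreal)"
    proof (cases "\<forall>j<k. P (\<omega> !! j)")
      case True then show ?thesis using \<omega> sp by (auto intro!: prod.neutral[symmetric])
    next
      case False
      then obtain j where "j < k" "\<not> P (\<omega> !! j)" by blast
      then have "(\<Prod>j<k. indicator {x \<in> space M. P x} (\<omega> !! j) :: ennreal) = 0"
        by (intro prod_zero) (auto intro!: bexI[of _ j])
      with False show ?thesis by simp
    qed
  qed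
  also have "\<dots> = emeasure M {x \<in> space M. P x} ^ k"
    by (subst nn_integral_stream_prod) simp_all
  finally show ?thesis
    by (simp add: S.emeasure_eq_measure emeasure_eq_measure ennreal_power)
qed

section \<open>The probability space of one step and of the whole process\<close>

lemma prob_space_step:
  assumes "n > 0"
  shows "prob_space (step_space Rd n)"
  unfolding step_space_def
  by (intro prob_space_pair prob_space_measure_pmf prob_space_exponential_density) simp

lemma prob_space_cov:
  assumes "n > 0"
  shows "prob_space (cov_space Rd n)"
  unfolding cov_space_def by (rule prob_space.prob_space_stream_space[OF prob_space_step[OF assms]])

text \<open>Measurability can now be proved once, for a sigma-algebra that mentions neither
  \<open>Rd\<close> nor \<open>n\<close>, and is transferred to every \<open>step_space Rd n\<close>
  and \<open>cov_space Rd n\<close>.\<close>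

lemma sets_step_space [measurable_cong]:
  "sets (step_space Rd n) = sets (count_space UNIV \<Otimes>\<^sub>M (count_space UNIV \<Otimes>\<^sub>M borel))"
  unfolding step_space_def
  by (intro sets_pair_measure_cong sets_measure_pmf_count_space) auto

lemma sets_cov_space [measurable_cong]:
  "sets (cov_space Rd n) = sets (stream_space (count_space UNIV \<Otimes>\<^sub>M (count_space UNIV \<Otimes>\<^sub>M borel)))"
  unfolding cov_space_def by (rule sets_stream_space_cong[OF sets_step_space])

lemma space_step_space [simp]: "space (step_space Rd n) = UNIV"
  by (simp add: step_space_def space_pair_measure)

lemma space_cov_space [simp]: "space (cov_space Rd n) = UNIV"
  by (simp add: cov_space_def space_stream_space)

lemma nn_integral_step_space:
  assumes n: "n > 0" and [measurable]: "g \<in> borel_measurable (step_space Rd n)"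
  shows "(\<integral>\<^sup>+z. g z \<partial>step_space Rd n)
       = (\<integral>\<^sup>+r. \<integral>\<^sup>+u. \<integral>\<^sup>+x. g (r, u, x) \<partial>density lborel (exponential_density 1)
            \<partial>pmf_of_set {0..<n} \<partial>Rd)"
proof -
  let ?E = "density lborel (exponential_density 1)" and ?U = "measure_pmf (pmf_of_set {0..<n})"
  interpret E: prob_space ?E by (rule prob_space_exponential_density) simp
  interpret UE: prob_space "?U \<Otimes>\<^sub>M ?E"
    by (intro prob_space_pair prob_space_measure_pmf E.prob_space_axioms)
  have [measurable]: "g \<in> borel_measurable (count_space UNIV \<Otimes>\<^sub>M (count_space UNIV \<Otimes>\<^sub>M borel))"
    using assms(2) by measurable
  have "(\<integral>\<^sup>+z. g z \<partial>step_space Rd n) = (\<integral>\<^sup>+r. \<integral>\<^sup>+y. g (r, y) \<partial>(?U \<Otimes>\<^sub>M ?E) \<partial>Rd)"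
    unfolding step_space_def by (rule UE.nn_integral_fst[symmetric]) measurable
  also have "\<dots> = (\<integral>\<^sup>+r. \<integral>\<^sup>+u. \<integral>\<^sup>+x. g (r, u, x) \<partial>?E \<partial>?U \<partial>Rd)"
    by (intro nn_integral_cong E.nn_integral_fst[symmetric]) measurable
  finally show ?thesis .
qed

lemma nn_integral_step_space_arrival:
  assumes n: "n > 0" and [measurable]: "h \<in> borel_measurable borel"
  shows "(\<integral>\<^sup>+z. h (snd (snd z)) \<partial>step_space Rd n) = (\<integral>\<^sup>+x. h x \<partial>density lborel (exponential_density 1))"
  by (subst nn_integral_step_space[OF n]) simp_all

text \<open>Exponential tilting: multiplied by \<open>exp (c * x)\<close>, the density of rate 1
  becomes \<open>1 / (1 - c)\<close> times the density of rate \<open>1 - c\<close>, which has total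
  mass 1.\<close>

lemma nn_integral_exp_exponential:
  fixes c :: real
  assumes "c < 1"
  shows "(\<integral>\<^sup>+x. ennreal (exp (c * x)) \<partial>density lborel (exponential_density 1)) = ennreal (1 / (1 - c))"
proof -
  interpret E: prob_space "density lborel (exponential_density (1 - c))"
    by (rule prob_space_exponential_density) (use assms in simp)
  have "(\<integral>\<^sup>+x. ennreal (exp (c * x)) \<partial>density lborel (exponential_density 1))
     = (\<integral>\<^sup>+x. ennreal (exponential_density 1 x) * ennreal (exp (c * x)) \<partial>lborel)"
    by (subst nn_integral_density) auto
  also have "\<dots> = (\<integral>\<^sup>+x. ennreal (1 / (1 - c)) * ennreal (exponential_density (1 - c) x) \<partial>lborel)"
    using assms
    by (intro nn_integral_cong)
       (auto simp: exponential_density_def ennreal_mult[symmetric] exp_add[symmetric]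
         right_diff_distrib mult.commute)
  also have "\<dots> = ennreal (1 / (1 - c)) * (\<integral>\<^sup>+x. ennreal (exponential_density (1 - c) x) \<partial>lborel)"
    by (subst nn_integral_cmult) auto
  also have "(\<integral>\<^sup>+x. ennreal (exponential_density (1 - c) x) \<partial>lborel) = 1"
    using E.emeasure_space_1 by (subst (asm) emeasure_density) auto
  finally show ?thesis by simp
qed

text \<open>The event ignores the waiting time, which integrates out to 1, and the uniform position
  turns the rest into counting. This reduces hitting probabilities to the geometry of the torus for
  a fixed radius.\<close>

lemma measure_step_space:
  assumes n: "n > 0"
  shows "measure (step_space Rd n) {z. P (fst z) (fst (snd z))}
       = measure_pmf.expectation Rd (\<lambda>r. real (card {u \<in> {0..<n}. P r u}) / real n)"
proof -
  interpret S: prob_space "step_space Rd n" by (rule prob_space_step[OF n])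
  interpret E: prob_space "density lborel (exponential_density 1)"
    by (rule prob_space_exponential_density) simp
  let ?A = "{z :: nat \<times> nat \<times> real. P (fst z) (fst (snd z))}"
  have A[measurable]: "?A \<in> sets (step_space Rd n)"
  proof -
    have "{z \<in> space (step_space Rd n). P (fst z) (fst (snd z))} \<in> sets (step_space Rd n)"
      by measurable
    then show ?thesis by simp
  qed
  have card_le: "card {u \<in> {0..<n}. P r u} \<le> n" for r
    by (rule order_trans[OF card_mono[of "{0..<n}"]]) auto
  have "emeasure (step_space Rd n) ?A = (\<integral>\<^sup>+z. indicator ?A z \<partial>step_space Rd n)"
    by simp
  also have "\<dots> = (\<integral>\<^sup>+r. \<integral>\<^sup>+u. \<integral>\<^sup>+x. indicator ?A (r, u, x) \<partial>density lborel (exponential_density 1)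
            \<partial>pmf_of_set {0..<n} \<partial>Rd)"
    by (rule nn_integral_step_space[OF n]) measurable
  also have "\<dots> = (\<integral>\<^sup>+r. \<integral>\<^sup>+u. indicator {u. P r u} u \<partial>pmf_of_set {0..<n} \<partial>Rd)"
  proof (intro nn_integral_cong)
    fix r u
    have "(\<integral>\<^sup>+x. indicator ?A (r, u, x) \<partial>density lborel (exponential_density 1))
       = (\<integral>\<^sup>+x. indicator {u. P r u} u \<partial>density lborel (exponential_density 1))"
      by (intro nn_integral_cong) (auto simp: indicator_def)
    also have "\<dots> = indicator {u. P r u} u"
      by (subst nn_integral_const) (simp add: E.emeasure_space_1[simplified])
    finally show "(\<integral>\<^sup>+x. indicator ?A (r, u, x) \<partial>density lborel (exponential_density 1)) = indicator {u. P r u} u" .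
  qed
  also have "\<dots> = (\<integral>\<^sup>+r. ennreal (real (card {u \<in> {0..<n}. P r u}) / real n) \<partial>Rd)"
    using n by (simp add: emeasure_pmf_of_set Int_def)
  also have "\<dots> = ennreal (measure_pmf.expectation Rd (\<lambda>r. real (card {u \<in> {0..<n}. P r u}) / real n))"
    using n card_le
    by (intro nn_integral_eq_integral measure_pmf.integrable_const_bound[where B = 1])
       (auto simp: field_simps)
  finally show ?thesis
    unfolding S.emeasure_eq_measure by (simp add: integral_nonneg_AE)
qed

section \<open>Covering and hitting\<close>

text \<open>\<open>(x + n - u) mod n\<close> is the cyclic distance from \<open>u\<close> forward to
  \<open>x\<close>; the added \<open>n\<close> keeps the subtraction on \<open>nat\<close> from
  truncating.\<close>

lemma mem_cov_object_iff:
  assumes "x < n" "u < n"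
  shows "x \<in> cov_object n u r \<longleftrightarrow> (x + n - u) mod n < r"
proof
  assume "x \<in> cov_object n u r"
  then obtain i where i: "i < r" "x = (u + i) mod n" by (auto simp: cov_object_def)
  have "(x + n - u) mod n = (x + (n - u)) mod n" using assms by simp
  also have "\<dots> = (u + i + (n - u)) mod n" using i(2) by (simp add: mod_add_left_eq)
  also have "u + i + (n - u) = i + n" using assms by simp
  finally have "(x + n - u) mod n = i mod n" by simp
  moreover have "i mod n \<le> i" by simp
  ultimately show "(x + n - u) mod n < r" using i(1) by linarith
next
  assume "(x + n - u) mod n < r"
  moreover have "(u + (x + n - u) mod n) mod n = x"
    using assms by (simp add: mod_add_right_eq)
  ultimately show "x \<in> cov_object n u r"
    unfolding cov_object_def by force
qed

text \<open>The reflection of the torus that sends \<open>u\<close> to \<open>x - u\<close> is its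
  own inverse.\<close>

lemma bij_betw_diff_mod:
  assumes "x < (n::nat)"
  shows "bij_betw (\<lambda>u. (x + n - u) mod n) {0..<n} {0..<n}"
proof (rule bij_betwI[where g = "\<lambda>u. (x + n - u) mod n"])
  show "(x + n - (x + n - u) mod n) mod n = u" if "u \<in> {0..<n}" for u
  proof (cases "u \<le> x")
    case True
    then have "(x + n - u) mod n = ((x - u) + n) mod n" by (simp only: Nat.diff_add_assoc2)
    also have "\<dots> = x - u" using assms by simp
    finally have e: "(x + n - u) mod n = x - u" .
    have "x + n - (x - u) = u + n" using True by linarith
    then show ?thesis unfolding e using that by simp
  next
    case False
    then have e: "(x + n - u) mod n = x + n - u" using that by simp
    have "u < n" using that by simp
    then have "x + n - (x + n - u) = u" by linarith
    then show ?thesis unfolding e using that by simp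
  qed
  then show "(x + n - (x + n - u) mod n) mod n = u" if "u \<in> {0..<n}" for u using that .
qed (use assms in \<open>simp_all only: Pi_iff Ball_def atLeastLessThan_iff mod_less_divisor[OF le_less_trans[OF le0 assms]] le0 ball_simps simp_thms\<close>)

text \<open>The rotation that sends \<open>y\<close> to \<open>y - x\<close> is inverted by the
  rotation that sends \<open>d\<close> to \<open>x + d\<close>.\<close>

lemma bij_betw_diff_mod':
  assumes "x < (n::nat)"
  shows "bij_betw (\<lambda>y. (y + n - x) mod n) {0..<n} {0..<n}"
proof (rule bij_betwI[where g = "\<lambda>d. (x + d) mod n"])
  show "(x + (y + n - x) mod n) mod n = y" if "y \<in> {0..<n}" for y
  proof -
    have "x + (y + n - x) = y + n" using assms by linarith
    then show ?thesis using that by (simp only: mod_add_right_eq) simp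
  qed
  show "((x + d) mod n + n - x) mod n = d" if "d \<in> {0..<n}" for d
  proof -
    have "(x + d) mod n + n - x = (x + d) mod n + (n - x)" using assms by linarith
    then have "((x + d) mod n + n - x) mod n = ((x + d) mod n + (n - x)) mod n" by (simp only:)
    also have "\<dots> = (x + d + (n - x)) mod n" by (simp add: mod_add_left_eq)
    also have "x + d + (n - x) = d + n" using assms by linarith
    finally show ?thesis using that by simp
  qed
qed (use assms in \<open>simp_all only: Pi_iff Ball_def atLeastLessThan_iff mod_less_divisor[OF le_less_trans[OF le0 assms]] le0 ball_simps simp_thms\<close>)

lemma card_cov_object:
  assumes "x < n"
  shows "card {u \<in> {0..<n}. x \<in> cov_object n u r} = min r n"
proof -
  have "{u \<in> {0..<n}. x \<in> cov_object n u r} = {u \<in> {0..<n}. (x + n - u) mod n < r}"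
    using mem_cov_object_iff[OF assms] by (intro Collect_cong) (metis atLeastLessThan_iff)
  then have "card {u \<in> {0..<n}. x \<in> cov_object n u r} = card {u \<in> {0..<n}. (x + n - u) mod n < r}"
    by (rule arg_cong)
  also have "\<dots> = card {v \<in> {0..<n}. v < r}"
    by (rule bij_betw_same_card[OF bij_betw_Collect[where Q = "\<lambda>v. v < r",
          OF bij_betw_diff_mod[OF assms] refl]])
  also have "{v \<in> {0..<n}. v < r} = {0..<min r n}" by auto
  finally show ?thesis by simp
qed

text \<open>Count by the distance \<open>v\<close> from the start of the object to \<open>x\<close>;
  the distance to \<open>y\<close> is then \<open>v + d\<close> modulo \<open>n\<close>. Without
  wrap-around both points are hit only if \<open>v + d < r\<close>, which leaves
  \<open>min r n - d\<close> values. With wrap-around \<open>v\<close> lies between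
  \<open>n - d\<close> and \<open>min r n\<close>. Truncated subtraction makes a term vanish when
  the object is too short for that arc.\<close>

lemma card_cov_object_both:
  assumes "x < n" "y < n" and d: "d = (y + n - x) mod n"
  shows "card {u \<in> {0..<n}. x \<in> cov_object n u r \<and> y \<in> cov_object n u r}
       \<le> (min r n - d) + (min r n - (n - d))"
proof -
  have dn: "d < n" unfolding d by (rule mod_less_divisor) (use assms(1) in linarith)
  have shift: "(y + n - u) mod n = ((x + n - u) mod n + d) mod n" if "u < n" for u
  proof -
    have "((x + n - u) mod n + d) mod n = ((x + n - u) + (y + n - x)) mod n"
      unfolding d by (rule mod_add_eq)
    also have "(x + n - u) + (y + n - x) = (y + n - u) + n" using assms(1,2) that by linarith
    finally show ?thesis by (simp only: mod_add_self2)
  qed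
  have iff: "(x \<in> cov_object n u r \<and> y \<in> cov_object n u r) \<longleftrightarrow>
      (x + n - u) mod n < r \<and> ((x + n - u) mod n + d) mod n < r" if "u \<in> {0..<n}" for u
  proof -
    have "u < n" using that by simp
    then show ?thesis
      by (simp only: mem_cov_object_iff[OF assms(1)] mem_cov_object_iff[OF assms(2)] shift[symmetric])
  qed
  have "{u \<in> {0..<n}. x \<in> cov_object n u r \<and> y \<in> cov_object n u r}
      = {u \<in> {0..<n}. (x + n - u) mod n < r \<and> ((x + n - u) mod n + d) mod n < r}"
    using iff by blast
  then have "card {u \<in> {0..<n}. x \<in> cov_object n u r \<and> y \<in> cov_object n u r}
      = card {u \<in> {0..<n}. (x + n - u) mod n < r \<and> ((x + n - u) mod n + d) mod n < r}"
    by (rule arg_cong)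
  also have "\<dots> = card {v \<in> {0..<n}. v < r \<and> (v + d) mod n < r}"
    by (rule bij_betw_same_card[OF bij_betw_Collect[where Q = "\<lambda>v. v < r \<and> (v + d) mod n < r",
          OF bij_betw_diff_mod[OF assms(1)] refl]])
  also have "\<dots> \<le> card ({..<min r n - d} \<union> {n - d..<min r n})"
  proof (rule card_mono)
    show "{v \<in> {0..<n}. v < r \<and> (v + d) mod n < r} \<subseteq> {..<min r n - d} \<union> {n - d..<min r n}"
    proof
      fix v assume "v \<in> {v \<in> {0..<n}. v < r \<and> (v + d) mod n < r}"
      then have v: "v < n" "v < r" "(v + d) mod n < r" by (simp_all only: mem_Collect_eq atLeastLessThan_iff)
      show "v \<in> {..<min r n - d} \<union> {n - d..<min r n}"
      proof (cases "v + d < n")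
        case True
        then have "(v + d) mod n = v + d" by (rule mod_less)
        then have "v < min r n - d" using v(3) True by linarith
        then show ?thesis by simp
      next
        case False
        then have "n - d \<le> v" by linarith
        then show ?thesis using v(1,2) by simp
      qed
    qed
  qed simp
  also have "\<dots> \<le> (min r n - d) + (min r n - (n - d))"
    by (rule order_trans[OF card_Un_le]) simp
  finally show ?thesis .
qed

section \<open>Tail sums and hitting probabilities\<close>

definition tail_sum :: "nat pmf \<Rightarrow> nat \<Rightarrow> nat \<Rightarrow> real" where
  "tail_sum Rd n d = (\<Sum>r = Suc d..n. tailf Rd r)"

lemma tailf_nonneg: "0 \<le> tailf Rd r" and tailf_le_1: "tailf Rd r \<le> 1"
  by (auto simp: tailf_def)

lemma tailf_antimono: "r \<le> s \<Longrightarrow> tailf Rd s \<le> tailf Rd r"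
  unfolding tailf_def by (intro measure_pmf.finite_measure_mono) auto

lemma tail_sum_nonneg: "0 \<le> tail_sum Rd n d"
  unfolding tail_sum_def by (intro sum_nonneg tailf_nonneg)

lemma tail_sum_le: "tail_sum Rd n 0 \<le> real n"
  unfolding tail_sum_def using sum_mono[of "{Suc 0..n}" "tailf Rd" "\<lambda>_. 1"] tailf_le_1 by simp

lemma integrable_min_diff: "integrable (measure_pmf Rd) (\<lambda>r. real (min r n - d))"
  by (rule measure_pmf.integrable_const_bound[where B = "real n"]) auto

text \<open>Layer-cake formula: \<open>min r n - d\<close> counts the \<open>i\<close> with
  \<open>d < i\<close>, \<open>i \<le> n\<close> and \<open>i \<le> r\<close>. Thus
  \<open>tail_sum\<close> is the mean of the truncated excess of the radius over \<open>d\<close>,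
  the quantity produced by counting positions.\<close>

lemma expectation_min_diff:
  "measure_pmf.expectation Rd (\<lambda>r. real (min r n - d)) = tail_sum Rd n d"
proof -
  have "real (min r n - d) = (\<Sum>i = Suc d..n. indicator {i..} r)" for r
  proof -
    have "(\<Sum>i = Suc d..n. indicator {i..} r :: real) = (\<Sum>i\<in>{Suc d..min r n}. 1)"
      by (rule sum.mono_neutral_cong_right) (auto simp: indicator_def)
    then show ?thesis by simp
  qed
  then have "measure_pmf.expectation Rd (\<lambda>r. real (min r n - d))
     = measure_pmf.expectation Rd (\<lambda>r. \<Sum>i = Suc d..n. indicator {i..} r)" by simp
  also have "\<dots> = tail_sum Rd n d"
    unfolding tail_sum_def tailf_def
    by (subst Bochner_Integration.integral_sum)
       (simp_all add: measure_pmf.integrable_const_bound[where B = 1])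
  finally show ?thesis .
qed

definition hits :: "nat \<Rightarrow> nat \<Rightarrow> nat \<times> nat \<times> real \<Rightarrow> bool" where
  "hits n x z \<longleftrightarrow> x \<in> cov_object n (fst (snd z)) (fst z)"

text \<open>\<open>P\<close> may be arbitrary because radius and position range over a countable
  discrete space.\<close>

lemma measurable_fst_snd_pred:
  "Measurable.pred (count_space UNIV \<Otimes>\<^sub>M (count_space UNIV \<Otimes>\<^sub>M borel))
     (\<lambda>z :: nat \<times> nat \<times> real. P (fst z) (fst (snd z)))"
  by measurable

lemma measurable_hits [measurable]:
  "Measurable.pred (count_space UNIV \<Otimes>\<^sub>M (count_space UNIV \<Otimes>\<^sub>M borel)) (hits n x)"
  unfolding hits_def[abs_def] by (rule measurable_fst_snd_pred)

lemma prob_hits: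
  assumes "x < n"
  shows "measure (step_space Rd n) {z. hits n x z} = tail_sum Rd n 0 / n"
proof -
  have "measure (step_space Rd n) {z. hits n x z}
      = measure_pmf.expectation Rd (\<lambda>r. real (min r n) / real n)"
    unfolding hits_def
    using measure_step_space[of n Rd "\<lambda>r u. x \<in> cov_object n u r"] assms card_cov_object[OF assms]
    by simp
  then show ?thesis using expectation_min_diff[of Rd n 0] by simp
qed

lemma prob_hits_both:
  assumes "x < n" "y < n" and d: "d = (y + n - x) mod n"
  shows "measure (step_space Rd n) {z. hits n x z \<and> hits n y z}
      \<le> (tail_sum Rd n d + tail_sum Rd n (n - d)) / n"
proof -
  have n: "n > 0" using assms(1) by simp
  note card = card_cov_object_both[OF assms(1,2) d]
  have "measure (step_space Rd n) {z. hits n x z \<and> hits n y z}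
      = measure_pmf.expectation Rd (\<lambda>r. real (card {u \<in> {0..<n}. x \<in> cov_object n u r \<and> y \<in> cov_object n u r}) / n)"
    unfolding hits_def by (rule measure_step_space[OF n])
  also have "\<dots> \<le> measure_pmf.expectation Rd (\<lambda>r. (real (min r n - d) + real (min r n - (n - d))) / n)"
  proof (rule integral_mono)
    show "integrable (measure_pmf Rd) (\<lambda>r. (real (min r n - d) + real (min r n - (n - d))) / n)"
      by (intro integrable_divide Bochner_Integration.integrable_add integrable_min_diff)
    show "integrable (measure_pmf Rd)
        (\<lambda>r. real (card {u \<in> {0..<n}. x \<in> cov_object n u r \<and> y \<in> cov_object n u r}) / n)"
    proof (rule measure_pmf.integrable_const_bound[where B = 2], intro always_eventually allI)
      fix r
      have "card {u \<in> {0..<n}. x \<in> cov_object n u r \<and> y \<in> cov_object n u r} \<le> 2 * n"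
        using card[of r] by linarith
      then show "norm (real (card {u \<in> {0..<n}. x \<in> cov_object n u r \<and> y \<in> cov_object n u r}) / n) \<le> 2"
        using n by (simp add: divide_le_eq)
    qed simp
    show "real (card {u \<in> {0..<n}. x \<in> cov_object n u r \<and> y \<in> cov_object n u r}) / n
        \<le> (real (min r n - d) + real (min r n - (n - d))) / n" for r
      using card[of r] by (intro divide_right_mono) (simp_all flip: of_nat_add)
  qed
  also have "\<dots> = (tail_sum Rd n d + tail_sum Rd n (n - d)) / n"
    by (simp add: integrable_min_diff expectation_min_diff)
  finally show ?thesis .
qed

section \<open>The covered set and the cover times as random variables\<close>

lemma covered_subset: "n > 0 \<Longrightarrow> covered n \<omega> k \<subseteq> {0..<n}"
  by (auto simp: covered_def cov_object_def)

lemma mem_covered_iff: "x \<in> covered n \<omega> k \<longleftrightarrow> (\<exists>j<k. hits n x (\<omega> !! j))"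
  by (auto simp: covered_def hits_def)

lemma measurable_mem_covered [measurable]:
  "Measurable.pred (stream_space (count_space UNIV \<Otimes>\<^sub>M (count_space UNIV \<Otimes>\<^sub>M borel))) (\<lambda>\<omega>. x \<in> covered n \<omega> k)"
  unfolding mem_covered_iff by measurable

lemma covered_eq_iff: "n > 0 \<Longrightarrow> covered n \<omega> k = {0..<n} \<longleftrightarrow> (\<forall>x\<in>{0..<n}. x \<in> covered n \<omega> k)"
  using covered_subset[of n \<omega> k] by blast

lemma measurable_covered_eq [measurable]:
  assumes "n > 0"
  shows "Measurable.pred (stream_space (count_space UNIV \<Otimes>\<^sub>M (count_space UNIV \<Otimes>\<^sub>M borel))) (\<lambda>\<omega>. covered n \<omega> k = {0..<n})"
  unfolding covered_eq_iff[OF assms] by measurable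

lemma measurable_cover_time [measurable]:
  assumes "n > 0"
  shows "cover_time n \<in> measurable (cov_space Rd n) (count_space UNIV)"
proof -
  have "Measurable.pred (cov_space Rd n) (\<lambda>\<omega>. covered n \<omega> k = {0..<n})" for k
    using measurable_covered_eq[OF assms] by (simp add: measurable_cong_sets[OF sets_cov_space refl])
  then show ?thesis
    unfolding cover_time_def[abs_def] by (rule measurable_Least)
qed

lemma measurable_arrival [measurable]:
  "(\<lambda>\<omega>. arrival \<omega> k) \<in> borel_measurable (cov_space Rd n)"
  unfolding arrival_def by measurable

lemma measurable_cont_cover_time [measurable]:
  assumes "n > 0"
  shows "cont_cover_time n \<in> borel_measurable (cov_space Rd n)"
  unfolding cont_cover_time_def[abs_def]
  by (rule measurable_compose_countable[OF measurable_arrival measurable_cover_time[OF assms]])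

lemma covered_mono: "k \<le> l \<Longrightarrow> covered n \<omega> k \<subseteq> covered n \<omega> l"
  unfolding covered_def by (intro UN_mono) auto

lemma cover_time_le: "covered n \<omega> k = {0..<n} \<Longrightarrow> cover_time n \<omega> \<le> k"
  unfolding cover_time_def by (rule Least_le)

text \<open>Some \<open>l\<close> with full covering is required: without one, the
  \<open>LEAST\<close> in \<open>cover_time\<close> is an unspecified number.\<close>

lemma cover_time_gt:
  assumes "n > 0" "covered n \<omega> k \<noteq> {0..<n}" "covered n \<omega> l = {0..<n}"
  shows "k < cover_time n \<omega>"
proof (rule ccontr)
  assume "\<not> k < cover_time n \<omega>"
  moreover have "covered n \<omega> (cover_time n \<omega>) = {0..<n}"
    unfolding cover_time_def using assms(3) by (rule LeastI)
  ultimately show False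
    using covered_mono[of "cover_time n \<omega>" k n \<omega>] covered_subset[OF assms(1), of \<omega> k] assms(2) by auto
qed

section \<open>Estimates for the cover times\<close>

text \<open>Stated for a general step event \<open>P\<close>, since it serves for hitting one point,
  for hitting one of two points, and for objects that cover the whole torus.\<close>

lemma prob_no_hit:
  assumes n: "n > 0"
    and [measurable]: "Measurable.pred (count_space UNIV \<Otimes>\<^sub>M (count_space UNIV \<Otimes>\<^sub>M borel)) P"
  shows "measure (cov_space Rd n) {\<omega>. \<forall>j<k. \<not> P (\<omega> !! j)} = (1 - measure (step_space Rd n) {z. P z}) ^ k"
proof -
  interpret S: prob_space "step_space Rd n" by (rule prob_space_step[OF n])
  have "Measurable.pred (step_space Rd n) P" by measurable
  then have [measurable]: "{z. P z} \<in> sets (step_space Rd n)"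
    by (simp add: pred_def)
  have "measure (cov_space Rd n) {\<omega>. \<forall>j<k. \<not> P (\<omega> !! j)} = measure (step_space Rd n) {z. \<not> P z} ^ k"
    using S.prob_stream_all_less[of "\<lambda>z. \<not> P z" k]
    by (simp add: cov_space_def space_stream_space)
  also have "{z. \<not> P z} = space (step_space Rd n) - {z. P z}" by auto
  finally show ?thesis by (simp add: S.prob_compl[simplified])
qed

lemma prob_uncovered:
  assumes "x < n"
  shows "measure (cov_space Rd n) {\<omega>. x \<notin> covered n \<omega> k} = (1 - tail_sum Rd n 0 / n) ^ k"
proof -
  have "measure (cov_space Rd n) {\<omega>. \<forall>j<k. \<not> hits n x (\<omega> !! j)} = (1 - tail_sum Rd n 0 / n) ^ k"
    using assms by (subst prob_no_hit) (simp_all add: prob_hits[OF assms])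
  then show ?thesis by (simp add: mem_covered_iff)
qed

text \<open>Inclusion-exclusion bounds from below the probability that one object hits
  \<open>x\<close> or \<open>y\<close>; both points stay uncovered iff all \<open>k\<close>
  independent objects avoid this event.\<close>

lemma prob_uncovered_both:
  assumes x: "x < n" and y: "y < n" and d: "d = (y + n - x) mod n"
  shows "measure (cov_space Rd n) {\<omega>. x \<notin> covered n \<omega> k \<and> y \<notin> covered n \<omega> k}
     \<le> (1 - 2 * (tail_sum Rd n 0 / n) + (tail_sum Rd n d + tail_sum Rd n (n - d)) / n) ^ k"
proof -
  have n: "n > 0" using x by simp
  interpret S: prob_space "step_space Rd n" by (rule prob_space_step[OF n])
  have ev: "{z. hits n x z} \<in> sets (step_space Rd n)" for x
  proof -
    have "Measurable.pred (step_space Rd n) (hits n x)" by measurable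
    then show ?thesis by (simp add: pred_def)
  qed
  have "measure (step_space Rd n) ({z. hits n x z} \<union> {z. hits n y z})
      = measure (step_space Rd n) {z. hits n x z} + measure (step_space Rd n) {z. hits n y z}
        - measure (step_space Rd n) ({z. hits n x z} \<inter> {z. hits n y z})"
    using ev by (intro measure_Un3) (auto simp: S.fmeasurable_eq_sets)
  then have q: "measure (step_space Rd n) {z. hits n x z \<or> hits n y z}
      \<ge> 2 * (tail_sum Rd n 0 / n) - (tail_sum Rd n d + tail_sum Rd n (n - d)) / n"
    using prob_hits_both[OF x y d, of Rd] prob_hits[OF x, of Rd] prob_hits[OF y, of Rd]
    by (simp add: Collect_disj_eq Collect_conj_eq)
  have "measure (cov_space Rd n) {\<omega>. \<forall>j<k. \<not> (hits n x (\<omega> !! j) \<or> hits n y (\<omega> !! j))}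
      = (1 - measure (step_space Rd n) {z. hits n x z \<or> hits n y z}) ^ k"
    by (rule prob_no_hit[OF n]) measurable
  also have "{\<omega>. \<forall>j<k. \<not> (hits n x (\<omega> !! j) \<or> hits n y (\<omega> !! j))}
      = {\<omega>. x \<notin> covered n \<omega> k \<and> y \<notin> covered n \<omega> k}"
    by (auto simp: mem_covered_iff)
  finally show ?thesis
    using q by (simp only:) (intro power_mono, auto)
qed

lemma sets_uncovered:
  "{\<omega>. x \<notin> covered n \<omega> k} \<in> sets (cov_space Rd n)"
proof -
  have "Measurable.pred (cov_space Rd n) (\<lambda>\<omega>. x \<notin> covered n \<omega> k)" by measurable
  then show ?thesis by (simp add: pred_def)
qed

lemma uncovered_eq_UN:
  assumes "n > 0"
  shows "{\<omega>. covered n \<omega> k \<noteq> {0..<n}} = (\<Union>x\<in>{0..<n}. {\<omega>. x \<notin> covered n \<omega> k})"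
  using covered_eq_iff[OF assms] by blast

lemma sets_not_covered:
  assumes "n > 0"
  shows "{\<omega>. covered n \<omega> k \<noteq> {0..<n}} \<in> sets (cov_space Rd n)"
  unfolding uncovered_eq_UN[OF assms] by (intro sets.finite_UN sets_uncovered) auto

lemma prob_not_covered_le:
  assumes n: "n > 0"
  shows "measure (cov_space Rd n) {\<omega>. covered n \<omega> k \<noteq> {0..<n}} \<le> real n * (1 - tail_sum Rd n 0 / n) ^ k"
proof -
  interpret C: prob_space "cov_space Rd n" by (rule prob_space_cov[OF n])
  have "measure (cov_space Rd n) {\<omega>. covered n \<omega> k \<noteq> {0..<n}}
     \<le> (\<Sum>x\<in>{0..<n}. measure (cov_space Rd n) {\<omega>. x \<notin> covered n \<omega> k})"
    unfolding uncovered_eq_UN[OF n]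
    by (rule C.finite_measure_subadditive_finite) (auto simp: sets_uncovered)
  also have "\<dots> = real n * (1 - tail_sum Rd n 0 / n) ^ k"
    by (simp add: prob_uncovered)
  finally show ?thesis .
qed

lemma tail_sum_0_le: "tail_sum Rd n 0 / n \<le> 1"
  using tail_sum_le[of Rd n] by (simp add: divide_le_eq)

text \<open>Never being covered implies not being covered after \<open>k\<close> objects, for every
  \<open>k\<close>, and the union bound for the latter decays geometrically because the hitting
  probability is positive. This makes the \<open>LEAST\<close> in \<open>cover_time\<close>
  meaningful almost surely.\<close>

lemma AE_eventually_covered:
  assumes n: "n > 0" and pos: "tail_sum Rd n 0 > 0"
  shows "AE \<omega> in cov_space Rd n. \<exists>k. covered n \<omega> k = {0..<n}"
proof -
  interpret C: prob_space "cov_space Rd n" by (rule prob_space_cov[OF n])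
  let ?N = "\<lambda>k. {\<omega>. covered n \<omega> k \<noteq> {0..<n}}"
  let ?M = "\<Inter>k. ?N k"
  let ?q = "1 - tail_sum Rd n 0 / n"
  have M: "?M \<in> sets (cov_space Rd n)"
    using sets_not_covered[OF n] by (intro sets.countable_INT) auto
  have "(\<lambda>k. real n * ?q ^ k) \<longlonglongrightarrow> real n * 0"
    using n pos tail_sum_0_le[of Rd n] by (intro tendsto_intros LIMSEQ_power_zero) auto
  moreover have "measure (cov_space Rd n) ?M \<le> real n * ?q ^ k" for k
    by (rule order_trans[OF C.finite_measure_mono prob_not_covered_le[OF n]])
       (use sets_not_covered[OF n] in auto)
  ultimately have "measure (cov_space Rd n) ?M \<le> real n * 0"
    by (intro LIMSEQ_le_const) auto
  then have "measure (cov_space Rd n) ?M = 0"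
    using measure_nonneg[of "cov_space Rd n" ?M] by linarith
  then have "?M \<in> null_sets (cov_space Rd n)"
    using M by (simp add: null_sets_def C.emeasure_eq_measure)
  then show ?thesis by (rule AE_I') auto
qed

text \<open>The waiting times live on all of the real line, so arrival times increase only almost
  surely; the exponential density vanishes on the negative half-line.\<close>

lemma AE_arrival_incr:
  assumes n: "n > 0"
  shows "AE \<omega> in cov_space Rd n. \<forall>j. snd (snd (\<omega> !! j)) \<ge> 0"
proof -
  interpret S: prob_space "step_space Rd n" by (rule prob_space_step[OF n])
  interpret C: prob_space "cov_space Rd n" by (rule prob_space_cov[OF n])
  have meas: "Measurable.pred (step_space Rd n) (\<lambda>z. snd (snd z) \<ge> 0)" by measurable
  have "(\<integral>\<^sup>+z. indicator {..<0} (snd (snd z)) \<partial>step_space Rd n)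
      = (\<integral>\<^sup>+x. indicator {..<0} x \<partial>density lborel (exponential_density 1))"
    by (rule nn_integral_step_space_arrival[OF n]) auto
  also have "\<dots> = (\<integral>\<^sup>+x. ennreal (exponential_density 1 x) * indicator {..<0} x \<partial>lborel)"
    by (subst nn_integral_density) auto
  also have "\<dots> = (\<integral>\<^sup>+(x::real). 0 \<partial>lborel)"
    by (intro nn_integral_cong) (auto simp: exponential_density_def indicator_def)
  finally have "(\<integral>\<^sup>+z. indicator {..<0} (snd (snd z)) \<partial>step_space Rd n) = 0" by simp
  then have "AE z in step_space Rd n. indicator {..<0::real} (snd (snd z)) = (0::ennreal)"
    by (subst (asm) nn_integral_0_iff_AE) auto
  then have ae: "AE z in step_space Rd n. snd (snd z) \<ge> 0"
    by eventually_elim (auto simp: indicator_def split: if_splits)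
  have "AE \<omega> in stream_space (step_space Rd n). stream_all (\<lambda>z. snd (snd z) \<ge> 0) \<omega>"
    by (rule S.AE_stream_all[OF meas ae])
  then show ?thesis
    unfolding cov_space_def by eventually_elim (simp add: stream.pred_set)
qed

text \<open>Markov's inequality for \<open>exp (c * arrival \<omega> k)\<close>, whose mean is a
  \<open>k\<close>-th power by independence. The sign of \<open>c\<close> selects the tail:
  \<open>c = 1/2\<close> bounds late arrivals and \<open>c = -1\<close> early ones. The resulting
  bases \<open>2 / exp 1\<close> and \<open>exp (1/2) / 2\<close> are both below 1.\<close>

lemma prob_arrival_chernoff:
  assumes n: "n > 0" and c: "c < 1"
  shows "measure (cov_space Rd n) {\<omega>. c * arrival \<omega> k \<ge> a} \<le> (1 / (1 - c)) ^ k * exp (- a)"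
proof -
  interpret S: prob_space "step_space Rd n" by (rule prob_space_step[OF n])
  interpret C: prob_space "cov_space Rd n" by (rule prob_space_cov[OF n])
  let ?A = "{\<omega>. c * arrival \<omega> k \<ge> a}"
  have "Measurable.pred (cov_space Rd n) (\<lambda>\<omega>. c * arrival \<omega> k \<ge> a)" by measurable
  then have A: "?A \<in> sets (cov_space Rd n)" by (simp add: pred_def)
  have "emeasure (cov_space Rd n) ?A = (\<integral>\<^sup>+\<omega>. indicator ?A \<omega> \<partial>cov_space Rd n)"
    using A by simp
  also have "\<dots> \<le> (\<integral>\<^sup>+\<omega>. ennreal (exp (- a)) * (\<Prod>j<k. ennreal (exp (c * snd (snd (\<omega> !! j))))) \<partial>cov_space Rd n)"
  proof (intro nn_integral_mono)
    fix \<omega>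
    have "ennreal (exp (- a)) * (\<Prod>j<k. ennreal (exp (c * snd (snd (\<omega> !! j))))) = ennreal (exp (c * arrival \<omega> k - a))"
      by (simp add: prod_ennreal arrival_def sum_distrib_left exp_sum ennreal_mult[symmetric] prod_nonneg
          exp_diff exp_minus field_simps)
    then show "indicator ?A \<omega> \<le> ennreal (exp (- a)) * (\<Prod>j<k. ennreal (exp (c * snd (snd (\<omega> !! j)))))"
      by (auto simp: indicator_def)
  qed
  also have "\<dots> = ennreal (exp (- a)) * (\<integral>\<^sup>+\<omega>. (\<Prod>j<k. ennreal (exp (c * snd (snd (\<omega> !! j))))) \<partial>cov_space Rd n)"
    by (rule nn_integral_cmult) measurable
  also have "(\<integral>\<^sup>+\<omega>. (\<Prod>j<k. ennreal (exp (c * snd (snd (\<omega> !! j))))) \<partial>cov_space Rd n)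
     = (\<integral>\<^sup>+z. ennreal (exp (c * snd (snd z))) \<partial>step_space Rd n) ^ k"
    unfolding cov_space_def by (rule S.nn_integral_stream_prod) measurable
  also have "(\<integral>\<^sup>+z. ennreal (exp (c * snd (snd z))) \<partial>step_space Rd n) = ennreal (1 / (1 - c))"
    by (subst nn_integral_step_space_arrival[OF n, of "\<lambda>x. ennreal (exp (c * x))"])
       (auto simp: nn_integral_exp_exponential[OF c])
  also have "ennreal (exp (- a)) * ennreal (1 / (1 - c)) ^ k = ennreal ((1 / (1 - c)) ^ k * exp (- a))"
    using c by (simp add: ennreal_power ennreal_mult[symmetric] mult.commute)
  finally show ?thesis
    using c by (simp add: C.emeasure_eq_measure)
qed

lemma prob_arrival_ge:
  assumes "n > 0"
  shows "measure (cov_space Rd n) {\<omega>. arrival \<omega> k \<ge> 2 * real k} \<le> (2 / exp 1) ^ k"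
proof -
  have "measure (cov_space Rd n) {\<omega>. 1/2 * arrival \<omega> k \<ge> real k} \<le> (1 / (1 - 1/2)) ^ k * exp (- real k)"
    by (rule prob_arrival_chernoff[OF assms]) simp
  then show ?thesis
    by (simp add: exp_minus exp_of_nat_mult[of k 1, simplified] field_simps)
qed

lemma prob_arrival_le:
  assumes "n > 0"
  shows "measure (cov_space Rd n) {\<omega>. arrival \<omega> k \<le> k / 2} \<le> (exp (1/2) / 2) ^ k"
proof -
  have "measure (cov_space Rd n) {\<omega>. (-1) * arrival \<omega> k \<ge> - (real k / 2)} \<le> (1 / (1 - (-1))) ^ k * exp (- (- (real k / 2)))"
    by (rule prob_arrival_chernoff[OF assms]) simp
  then show ?thesis
    using exp_of_nat_mult[of k "1/2 :: real"] by (simp add: field_simps)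
qed


section \<open>Passing from the number of objects to continuous time\<close>

lemma arrival_mono:
  assumes "\<And>j. snd (snd (\<omega> !! j)) \<ge> 0" "k \<le> l"
  shows "arrival \<omega> k \<le> arrival \<omega> l"
  unfolding arrival_def using assms by (intro sum_mono2) auto

lemma sets_cov_spaceI:
  assumes "Measurable.pred (cov_space Rd n) P"
  shows "{\<omega>. P \<omega>} \<in> sets (cov_space Rd n)"
  using assms by (simp add: pred_def)

lemma prob_cover_time_gt:
  assumes n: "n > 0"
  shows "measure (cov_space Rd n) {\<omega>. cover_time n \<omega> > k} \<le> real n * (1 - tail_sum Rd n 0 / n) ^ k"
proof -
  interpret C: prob_space "cov_space Rd n" by (rule prob_space_cov[OF n])
  have "{\<omega>. cover_time n \<omega> > k} \<subseteq> {\<omega>. covered n \<omega> k \<noteq> {0..<n}}"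
    using cover_time_le[of n _ k] by (auto simp: not_le[symmetric])
  then have "measure (cov_space Rd n) {\<omega>. cover_time n \<omega> > k}
      \<le> measure (cov_space Rd n) {\<omega>. covered n \<omega> k \<noteq> {0..<n}}"
    using sets_not_covered[OF n] by (intro C.finite_measure_mono)
  then show ?thesis using prob_not_covered_le[OF n, of Rd k] by linarith
qed

text \<open>If \<open>k\<close> objects cover the torus, the continuous cover time is at most the
  \<open>k\<close>-th arrival time. Exceeding \<open>2 * k\<close> therefore forces an uncovered
  point or a late \<open>k\<close>-th arrival.\<close>

lemma prob_cont_cover_time_gt:
  assumes n: "n > 0"
  shows "measure (cov_space Rd n) {\<omega>. cont_cover_time n \<omega> > 2 * real k}
     \<le> measure (cov_space Rd n) {\<omega>. covered n \<omega> k \<noteq> {0..<n}} + (2 / exp 1) ^ k"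
proof -
  interpret C: prob_space "cov_space Rd n" by (rule prob_space_cov[OF n])
  have S: "{\<omega>. arrival \<omega> k \<ge> 2 * real k} \<in> sets (cov_space Rd n)"
    by (rule sets_cov_spaceI) measurable
  note N = sets_not_covered[OF n, of k Rd]
  have T[measurable]: "cont_cover_time n \<in> borel_measurable (cov_space Rd n)"
    by (rule measurable_cont_cover_time[OF n])
  have "measure (cov_space Rd n) {\<omega>. cont_cover_time n \<omega> > 2 * real k}
    \<le> measure (cov_space Rd n) ({\<omega>. covered n \<omega> k \<noteq> {0..<n}} \<union> {\<omega>. arrival \<omega> k \<ge> 2 * real k})"
  proof (rule C.finite_measure_mono_AE)
    show "AE \<omega> in cov_space Rd n. \<omega> \<in> {\<omega>. cont_cover_time n \<omega> > 2 * real k} \<longrightarrow>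
       \<omega> \<in> {\<omega>. covered n \<omega> k \<noteq> {0..<n}} \<union> {\<omega>. arrival \<omega> k \<ge> 2 * real k}"
      using AE_arrival_incr[OF n]
    proof eventually_elim
      case (elim \<omega>)
      show ?case
      proof (cases "covered n \<omega> k = {0..<n}")
        case True
        then have "cont_cover_time n \<omega> \<le> arrival \<omega> k"
          unfolding cont_cover_time_def using elim by (intro arrival_mono cover_time_le) auto
        then show ?thesis by auto
      qed auto
    qed
  qed (use S N in auto)
  also have "\<dots> \<le> measure (cov_space Rd n) {\<omega>. covered n \<omega> k \<noteq> {0..<n}}
      + measure (cov_space Rd n) {\<omega>. arrival \<omega> k \<ge> 2 * real k}"
    by (rule measure_Un_le[OF N S])
  finally show ?thesis using prob_arrival_ge[OF n, of Rd k] by linarith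
qed

text \<open>If \<open>k\<close> objects leave a point uncovered, the cover time almost surely comes
  at or after the \<open>k\<close>-th arrival. A cover time of at most \<open>k / 2\<close> thus
  forces full covering or an early \<open>k\<close>-th arrival.\<close>

lemma prob_cont_cover_time_le:
  assumes n: "n > 0" and pos: "tail_sum Rd n 0 > 0"
  shows "measure (cov_space Rd n) {\<omega>. cont_cover_time n \<omega> \<le> k / 2}
     \<le> 1 - measure (cov_space Rd n) {\<omega>. covered n \<omega> k \<noteq> {0..<n}} + (exp (1/2) / 2) ^ k"
proof -
  interpret C: prob_space "cov_space Rd n" by (rule prob_space_cov[OF n])
  have S: "{\<omega>. arrival \<omega> k \<le> k / 2} \<in> sets (cov_space Rd n)"
    by (rule sets_cov_spaceI) measurable
  let ?N = "{\<omega>. covered n \<omega> k \<noteq> {0..<n}}"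
  note N = sets_not_covered[OF n, of k Rd]
  then have N': "- ?N \<in> sets (cov_space Rd n)" by (metis sets.compl_sets space_cov_space Compl_eq_Diff_UNIV)
  have T[measurable]: "cont_cover_time n \<in> borel_measurable (cov_space Rd n)"
    by (rule measurable_cont_cover_time[OF n])
  have "measure (cov_space Rd n) {\<omega>. cont_cover_time n \<omega> \<le> k / 2}
    \<le> measure (cov_space Rd n) (- ?N \<union> {\<omega>. arrival \<omega> k \<le> k / 2})"
  proof (rule C.finite_measure_mono_AE)
    show "AE \<omega> in cov_space Rd n. \<omega> \<in> {\<omega>. cont_cover_time n \<omega> \<le> k / 2} \<longrightarrow>
       \<omega> \<in> - ?N \<union> {\<omega>. arrival \<omega> k \<le> k / 2}"
      using AE_arrival_incr[OF n] AE_eventually_covered[OF n pos]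
    proof eventually_elim
      case (elim \<omega>)
      show ?case
      proof (cases "covered n \<omega> k = {0..<n}")
        case False
        then have "k < cover_time n \<omega>" using elim(2) cover_time_gt[OF n] by blast
        then have "arrival \<omega> k \<le> cont_cover_time n \<omega>"
          unfolding cont_cover_time_def using elim(1) by (intro arrival_mono) auto
        then show ?thesis by auto
      qed auto
    qed
  qed (use S N' in auto)
  also have "\<dots> \<le> measure (cov_space Rd n) (- ?N) + measure (cov_space Rd n) {\<omega>. arrival \<omega> k \<le> k / 2}"
    by (rule measure_Un_le[OF N' S])
  also have "measure (cov_space Rd n) (- ?N) = 1 - measure (cov_space Rd n) ?N"
    using C.prob_compl[OF N] by (simp add: Compl_eq_Diff_UNIV)
  finally show ?thesis using prob_arrival_le[OF n, of Rd k] by linarith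
qed

section \<open>Covering by a single long object\<close>

lemma cov_object_full:
  assumes "n > 0" "u < n" "r \<ge> n"
  shows "cov_object n u r = {0..<n}"
proof -
  have "x \<in> cov_object n u r" if "x < n" for x
    unfolding mem_cov_object_iff[OF that assms(2)]
    by (rule less_le_trans[OF mod_less_divisor[OF assms(1)] assms(3)])
  moreover have "cov_object n u r \<subseteq> {0..<n}" using assms(1) by (auto simp: cov_object_def)
  ultimately show ?thesis by auto
qed

text \<open>The condition on the position holds almost surely, so it costs no probability; it
  supplies the hypothesis of \<open>cov_object_full\<close>.\<close>

lemma prob_full_object:
  assumes n: "n > 0"
  shows "measure (step_space Rd n) {z. fst z \<ge> n \<and> fst (snd z) < n} = tailf Rd n"
proof -
  have "real (card {u \<in> {0..<n}. n \<le> r \<and> u < n}) / real n = indicator {n..} r" for r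
    using n by (cases "n \<le> r") (auto simp: indicator_def)
  then show ?thesis
    using measure_step_space[OF n, of Rd "\<lambda>r u. n \<le> r \<and> u < n"] by (simp add: tailf_def)
qed

lemma prob_not_covered_le_tailf:
  assumes n: "n > 0"
  shows "measure (cov_space Rd n) {\<omega>. covered n \<omega> k \<noteq> {0..<n}} \<le> (1 - tailf Rd n) ^ k"
proof -
  interpret C: prob_space "cov_space Rd n" by (rule prob_space_cov[OF n])
  let ?P = "\<lambda>z :: nat \<times> nat \<times> real. fst z \<ge> n \<and> fst (snd z) < n"
  have P: "Measurable.pred (count_space UNIV \<Otimes>\<^sub>M (count_space UNIV \<Otimes>\<^sub>M borel)) ?P"
    by (rule measurable_fst_snd_pred)
  have "{\<omega>. covered n \<omega> k \<noteq> {0..<n}} \<subseteq> {\<omega>. \<forall>j<k. \<not> ?P (\<omega> !! j)}"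
  proof (rule subsetI, rule CollectI, intro allI impI notI)
    fix \<omega> j assume "\<omega> \<in> {\<omega>. covered n \<omega> k \<noteq> {0..<n}}" and j: "j < k"
      and "n \<le> fst (\<omega> !! j) \<and> fst (snd (\<omega> !! j)) < n"
    then have "covered n \<omega> k \<noteq> {0..<n}" "n \<le> fst (\<omega> !! j)" "fst (snd (\<omega> !! j)) < n"
      by auto
    then have "{0..<n} \<subseteq> covered n \<omega> k"
      unfolding covered_def using cov_object_full[OF n, of "fst (snd (\<omega> !! j))" "fst (\<omega> !! j)"] j by blast
    with \<open>covered n \<omega> k \<noteq> {0..<n}\<close> covered_subset[OF n, of \<omega> k] show False by blast
  qed
  moreover have "{\<omega>. \<forall>j<k. \<not> ?P (\<omega> !! j)} \<in> sets (cov_space Rd n)"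
    using P by (intro sets_cov_spaceI) measurable
  ultimately have "measure (cov_space Rd n) {\<omega>. covered n \<omega> k \<noteq> {0..<n}}
      \<le> measure (cov_space Rd n) {\<omega>. \<forall>j<k. \<not> ?P (\<omega> !! j)}"
    by (rule C.finite_measure_mono)
  then show ?thesis
    unfolding prob_no_hit[OF n P] prob_full_object[OF n] .
qed

text \<open>Paley--Zygmund, from \<open>2 * t * N - t\<^sup>2 * N\<^sup>2 \<le> 1\<close> on the union and the optimal choice of \<open>t\<close>, where \<open>N\<close> counts
  the occurring events.\<close>
lemma (in prob_space) second_moment_UN:
  assumes I: "finite I" and A: "\<And>i. i \<in> I \<Longrightarrow> A i \<in> events"
  shows "(\<Sum>i\<in>I. prob (A i))\<^sup>2 \<le> prob (\<Union>i\<in>I. A i) * (\<Sum>i\<in>I. \<Sum>j\<in>I. prob (A i \<inter> A j))"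
proof -
  define N where "N \<omega> = (\<Sum>i\<in>I. indicator (A i) \<omega> :: real)" for \<omega>
  define a where "a = (\<Sum>i\<in>I. prob (A i))"
  define s where "s = (\<Sum>i\<in>I. \<Sum>j\<in>I. prob (A i \<inter> A j))"
  have int1: "integrable M (indicator (A i) :: _ \<Rightarrow> real)" if "i \<in> I" for i
    using A[OF that] by (intro integrable_const_bound[where B = 1]) auto
  have int2: "integrable M (\<lambda>\<omega>. indicator (A i) \<omega> * indicator (A j) \<omega> :: real)" if "i \<in> I" "j \<in> I" for i j
    using A[OF that(1)] A[OF that(2)] by (intro integrable_const_bound[where B = 1]) (auto simp: indicator_def)
  have N: "integrable M N" and EN: "expectation N = a"
    unfolding N_def[abs_def] a_def using A int1 by (auto simp: Bochner_Integration.integral_sum)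
  have N2eq: "(N \<omega>)\<^sup>2 = (\<Sum>i\<in>I. \<Sum>j\<in>I. indicator (A i) \<omega> * indicator (A j) \<omega>)" for \<omega>
    unfolding N_def power2_eq_square by (rule sum_product)
  have N2: "integrable M (\<lambda>\<omega>. (N \<omega>)\<^sup>2)"
    unfolding N2eq using int2 by auto
  have EN2: "expectation (\<lambda>\<omega>. (N \<omega>)\<^sup>2) = s"
  proof -
    have "expectation (\<lambda>\<omega>. (N \<omega>)\<^sup>2) = (\<Sum>i\<in>I. \<Sum>j\<in>I. expectation (\<lambda>\<omega>. indicator (A i) \<omega> * indicator (A j) \<omega>))"
      unfolding N2eq using int2 by (simp add: Bochner_Integration.integral_sum)
    also have "\<dots> = s"
      unfolding s_def
    proof (intro sum.cong refl)
      fix i j assume "i \<in> I" "j \<in> I"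
      then show "expectation (\<lambda>\<omega>. indicator (A i) \<omega> * indicator (A j) \<omega>) = prob (A i \<inter> A j)"
        using A by (simp add: indicator_inter_arith[symmetric] sets.Int)
    qed
    finally show ?thesis .
  qed
  have U: "(\<Union>i\<in>I. A i) \<in> events" using I A by auto
  have key: "2 * t * a - t\<^sup>2 * s \<le> prob (\<Union>i\<in>I. A i)" for t
  proof -
    have "2 * t * a - t\<^sup>2 * s = expectation (\<lambda>\<omega>. 2 * t * N \<omega> - t\<^sup>2 * (N \<omega>)\<^sup>2)"
      using N N2 by (simp add: EN EN2)
    also have "\<dots> \<le> expectation (indicator (\<Union>i\<in>I. A i))"
    proof (rule integral_mono)
      fix \<omega>
      show "2 * t * N \<omega> - t\<^sup>2 * (N \<omega>)\<^sup>2 \<le> indicator (\<Union>i\<in>I. A i) \<omega>"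
      proof (cases "\<omega> \<in> (\<Union>i\<in>I. A i)")
        case True
        have "0 \<le> (1 - t * N \<omega>)\<^sup>2" by simp
        then show ?thesis using True by (simp add: power2_eq_square algebra_simps)
      next
        case False
        then have "N \<omega> = 0" by (auto simp: N_def intro!: sum.neutral)
        then show ?thesis by simp
      qed
    qed (use N N2 U integrable_const_bound[where B = 1 and f = "indicator (\<Union>i\<in>I. A i) :: _ \<Rightarrow> real"] in auto)
    also have "\<dots> = prob (\<Union>i\<in>I. A i)" using U by simp
    finally show ?thesis .
  qed
  have s0: "s \<ge> 0" unfolding s_def by (intro sum_nonneg) auto
  have a0: "a \<ge> 0" unfolding a_def by (intro sum_nonneg) auto
  have "a\<^sup>2 \<le> prob (\<Union>i\<in>I. A i) * s"
  proof (cases "s = 0")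
    case True
    have "a = 0"
    proof (rule ccontr)
      assume "a \<noteq> 0"
      \<comment> \<open>For \<open>s = 0\<close> the choice \<open>t = 1 / a\<close> makes the left
        side of \<open>key\<close> equal to 2, which exceeds any probability.\<close>
      then show False using key[of "1 / a"] True prob_le_1[of "\<Union>i\<in>I. A i"] by simp
    qed
    then show ?thesis using True by simp
  next
    case False
    have "a\<^sup>2 / s \<le> prob (\<Union>i\<in>I. A i)"
      using key[of "a / s"] False by (simp add: power2_eq_square field_simps)
    then show ?thesis using False s0 by (simp add: divide_le_eq)
  qed
  then show ?thesis by (simp add: a_def s_def)
qed

section \<open>A lower bound for the probability of an uncovered point\<close>

lemma sum_inverse_sqrt_le: "(\<Sum>d<n. 1 / sqrt (real d + 2)) \<le> 2 * sqrt (real n + 1)"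
proof (induction n)
  case (Suc n)
  \<comment> \<open>The new summand is at most the increment
    \<open>2 * sqrt (n + 2) - 2 * sqrt (n + 1)\<close> of the bound; this follows by expanding the
    square.\<close>
  have "0 \<le> (sqrt (real n + 2) - sqrt (real n + 1))\<^sup>2" by simp
  then have "2 * (sqrt (real n + 2) * sqrt (real n + 1)) + 1 \<le> 2 * (sqrt (real n + 2) * sqrt (real n + 2))"
    by (simp add: power2_eq_square algebra_simps)
  then have "1 \<le> (2 * sqrt (real n + 2) - 2 * sqrt (real n + 1)) * sqrt (real n + 2)"
    by (simp add: algebra_simps)
  then have "1 / sqrt (real n + 2) \<le> 2 * sqrt (real n + 2) - 2 * sqrt (real n + 1)"
    by (simp add: divide_le_eq)
  then show ?case using Suc by (simp add: add.commute)
qed simp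

lemma sum_sqrt_ratio_le:
  assumes n: "n > 0"
  shows "(\<Sum>d<n. sqrt ((real n + 2) / (real d + 2))) \<le> 6 * n"
    and "(\<Sum>d<n. sqrt ((real n + 2) / (real (n - d) + 2))) \<le> 6 * n"
proof -
  have "(\<Sum>d<n. sqrt ((real n + 2) / (real d + 2))) = sqrt (real n + 2) * (\<Sum>d<n. 1 / sqrt (real d + 2))"
    by (simp add: sum_distrib_left real_sqrt_divide)
  also have "\<dots> \<le> sqrt (real n + 2) * (2 * sqrt (real n + 2))"
    using sum_inverse_sqrt_le[of n] by (intro mult_left_mono order_trans[OF sum_inverse_sqrt_le]) auto
  also have "\<dots> = 2 * (sqrt (real n + 2) * sqrt (real n + 2))" by (simp only: mult.left_commute)
  also have "\<dots> = 2 * (real n + 2)" by simp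
  \<comment> \<open>The constant 6 is forced by \<open>n = 1\<close>, where both sides are
    equal.\<close>
  also have "\<dots> \<le> 6 * n" using n by simp
  finally show *: "(\<Sum>d<n. sqrt ((real n + 2) / (real d + 2))) \<le> 6 * n" .
  have "(\<Sum>d<n. sqrt ((real n + 2) / (real (n - d) + 2))) = (\<Sum>d<n. sqrt ((real n + 2) / (real (Suc d) + 2)))"
    by (rule sum.reindex_bij_witness[where i = "\<lambda>d. n - Suc d" and j = "\<lambda>d. n - Suc d"])
       auto
  also have "\<dots> \<le> (\<Sum>d<n. sqrt ((real n + 2) / (real d + 2)))"
    by (intro sum_mono real_sqrt_le_mono divide_left_mono) auto
  finally show "(\<Sum>d<n. sqrt ((real n + 2) / (real (n - d) + 2))) \<le> 6 * n" using * by linarith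
qed

text \<open>Second moment method for the number of uncovered points, whose mean is
  \<open>n * (1 - p) ^ k\<close>. The assumption \<open>F\<close> turns the correlation of two
  points at distance \<open>d\<close> into a factor \<open>w d\<close> whose average over
  \<open>d\<close> is at most 6, so the second moment is at most 6 times the squared mean. In the
  constant 8, a factor 4 comes from \<open>half\<close> and a factor 2 from separating the two
  distances \<open>d\<close> and \<open>n - d\<close>.\<close>

lemma prob_not_covered_ge:
  assumes n: "n > 0"
    and half: "tail_sum Rd n 0 / n \<le> 1 / 2"
    and F: "\<And>d. d \<le> n \<Longrightarrow> 8 * k * tail_sum Rd n d / n \<le> ln ((real n + 2) / (real d + 2)) / 2"
  shows "measure (cov_space Rd n) {\<omega>. covered n \<omega> k \<noteq> {0..<n}} \<ge> 1 / 6"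
proof -
  interpret C: prob_space "cov_space Rd n" by (rule prob_space_cov[OF n])
  define p where "p = tail_sum Rd n 0 / n"
  define A where "A x = {\<omega>. x \<notin> covered n \<omega> k}" for x
  define \<phi> where "\<phi> d = sqrt ((real n + 2) / (real d + 2))" for d
  define w where "w d = (\<phi> d + \<phi> (n - d)) / 2" for d
  have p: "0 \<le> p" "p \<le> 1/2" using half by (auto simp: p_def tail_sum_nonneg)
  have pk: "(1 - p) ^ k > 0" using p by auto
  have exp_le: "exp (8 * k * tail_sum Rd n d / n) \<le> \<phi> d" if "d \<le> n" for d
  proof -
    have "exp (8 * k * tail_sum Rd n d / n) \<le> exp (ln ((real n + 2) / (real d + 2)) / 2)"
      using F[OF that] by simp
    also have "\<dots> = \<phi> d"
      unfolding \<phi>_def by (simp add: ln_sqrt[symmetric] add_pos_nonneg)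
    finally show ?thesis .
  qed
  have both: "measure (cov_space Rd n) (A x \<inter> A y) \<le> ((1 - p) ^ k)\<^sup>2 * w ((y + n - x) mod n)"
    if xy: "x < n" "y < n" for x y
  proof -
    define d where "d = (y + n - x) mod n"
    define a b where "a = tail_sum Rd n d / n" and "b = tail_sum Rd n (n - d) / n"
    have d: "d \<le> n" using n unfolding d_def by (intro less_imp_le mod_less_divisor)
    have ab: "0 \<le> a" "0 \<le> b" by (simp_all add: a_def b_def tail_sum_nonneg)
    \<comment> \<open>Since \<open>p \<le> 1/2\<close>, the square of \<open>1 - p\<close> is at
      least \<open>1/4\<close>, so the excess \<open>a + b\<close> can be absorbed into a factor
      \<open>1 + 4 * (a + b)\<close>.\<close>
    have "1 - 2 * p + (a + b) \<le> (1 - p)\<^sup>2 * (1 + 4 * (a + b))"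
    proof -
      have "(1/2)\<^sup>2 \<le> (1 - p)\<^sup>2" using p by (intro power_mono) auto
      then have "1/4 * (4 * (a + b)) \<le> (1 - p)\<^sup>2 * (4 * (a + b))"
        using ab by (intro mult_right_mono) (auto simp: power2_eq_square)
      then have "a + b \<le> (1 - p)\<^sup>2 * (4 * (a + b))" by simp
      moreover have "1 - 2 * p \<le> (1 - p)\<^sup>2" by (simp add: power2_eq_square algebra_simps)
      ultimately have "1 - 2 * p + (a + b) \<le> (1 - p)\<^sup>2 + (1 - p)\<^sup>2 * (4 * (a + b))"
        by (rule add_mono[rotated])
      then show ?thesis by (simp only: distrib_left mult_1_right)
    qed
    also have "\<dots> \<le> (1 - p)\<^sup>2 * exp (4 * (a + b))"
      by (intro mult_left_mono exp_ge_add_one_self) auto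
    finally have "(1 - 2 * p + (a + b)) ^ k \<le> ((1 - p)\<^sup>2 * exp (4 * (a + b))) ^ k"
      using p ab by (intro power_mono) auto
    also have "\<dots> = ((1 - p) ^ k)\<^sup>2 * exp (4 * k * (a + b))"
      by (simp add: exp_of_nat_mult[symmetric] power_mult[symmetric] algebra_simps)
    also have "exp (4 * k * (a + b)) \<le> w d"
    proof -
      \<comment> \<open>The inequality of arithmetic and geometric means splits the product of the
        two exponentials into a sum, at the price of doubling the exponents.\<close>
      have "0 \<le> (exp (4 * k * a) - exp (4 * k * b))\<^sup>2" by simp
      then have "2 * exp (4 * k * (a + b)) \<le> exp (8 * k * a) + exp (8 * k * b)"
        by (simp add: power2_eq_square algebra_simps exp_add[symmetric])
      also have "\<dots> \<le> \<phi> d + \<phi> (n - d)"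
        using exp_le[OF d] exp_le[of "n - d"] by (intro add_mono) (auto simp: a_def b_def)
      finally show ?thesis by (simp add: w_def)
    qed
    finally have "(1 - 2 * p + (a + b)) ^ k \<le> ((1 - p) ^ k)\<^sup>2 * w d"
      by (simp add: mult_left_mono)
    moreover have "measure (cov_space Rd n) (A x \<inter> A y) \<le> (1 - 2 * p + (a + b)) ^ k"
      using prob_uncovered_both[OF xy d_def, of Rd k]
      by (simp add: A_def p_def a_def b_def Collect_conj_eq add_divide_distrib)
    ultimately show ?thesis unfolding d_def by linarith
  qed
  have sumw: "(\<Sum>y\<in>{0..<n}. w ((y + n - x) mod n)) \<le> 6 * n" if "x < n" for x
  proof -
    \<comment> \<open>For fixed \<open>x\<close> the distance to \<open>y\<close> runs once through
      all residues, so the sum does not depend on \<open>x\<close>.\<close>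
    have "(\<Sum>y\<in>{0..<n}. w ((y + n - x) mod n)) = (\<Sum>d\<in>{0..<n}. w d)"
      by (rule sum.reindex_bij_betw[OF bij_betw_diff_mod'[OF that]])
    also have "\<dots> = ((\<Sum>d<n. \<phi> d) + (\<Sum>d<n. \<phi> (n - d))) / 2"
      by (simp add: w_def sum.distrib sum_divide_distrib[symmetric] atLeast0LessThan)
    also have "\<dots> \<le> 6 * n"
      using sum_sqrt_ratio_le[OF n] by (simp add: \<phi>_def)
    finally show ?thesis .
  qed
  have "(\<Sum>x\<in>{0..<n}. \<Sum>y\<in>{0..<n}. measure (cov_space Rd n) (A x \<inter> A y))
     \<le> (\<Sum>x\<in>{0..<n}. \<Sum>y\<in>{0..<n}. ((1 - p) ^ k)\<^sup>2 * w ((y + n - x) mod n))"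
    by (intro sum_mono both) auto
  also have "\<dots> = (\<Sum>x\<in>{0..<n}. ((1 - p) ^ k)\<^sup>2 * (\<Sum>y\<in>{0..<n}. w ((y + n - x) mod n)))"
    by (simp only: sum_distrib_left)
  also have "\<dots> \<le> (\<Sum>x\<in>{0..<n}. ((1 - p) ^ k)\<^sup>2 * (6 * n))"
    by (intro sum_mono mult_left_mono sumw) auto
  also have "\<dots> = 6 * (real n * (1 - p) ^ k)\<^sup>2"
    by (simp add: power2_eq_square)
  finally have second: "(\<Sum>x\<in>{0..<n}. \<Sum>y\<in>{0..<n}. measure (cov_space Rd n) (A x \<inter> A y))
     \<le> 6 * (real n * (1 - p) ^ k)\<^sup>2" .
  have "(\<Sum>x\<in>{0..<n}. measure (cov_space Rd n) (A x))\<^sup>2 \<le> measure (cov_space Rd n) (\<Union>x\<in>{0..<n}. A x)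
     * (\<Sum>x\<in>{0..<n}. \<Sum>y\<in>{0..<n}. measure (cov_space Rd n) (A x \<inter> A y))"
    by (rule C.second_moment_UN) (auto simp: A_def sets_uncovered)
  also have "\<dots> \<le> measure (cov_space Rd n) (\<Union>x\<in>{0..<n}. A x) * (6 * (real n * (1 - p) ^ k)\<^sup>2)"
    by (intro mult_left_mono second) simp
  also have "(\<Sum>x\<in>{0..<n}. measure (cov_space Rd n) (A x)) = real n * (1 - p) ^ k"
    by (simp add: A_def p_def prob_uncovered)
  finally have "(real n * (1 - p) ^ k)\<^sup>2 * 1
      \<le> (real n * (1 - p) ^ k)\<^sup>2 * (6 * measure (cov_space Rd n) (\<Union>x\<in>{0..<n}. A x))"
    by (simp only: mult_1_right mult.left_commute mult.commute)
  then have "1 \<le> 6 * measure (cov_space Rd n) (\<Union>x\<in>{0..<n}. A x)"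
    by (rule mult_left_le_imp_le) (rule zero_less_power, rule mult_pos_pos, use n pk in simp_all)
  then have "1 / 6 \<le> measure (cov_space Rd n) (\<Union>x\<in>{0..<n}. A x)" by simp
  then show ?thesis
    unfolding uncovered_eq_UN[OF n] A_def .
qed

section \<open>Sums of the tail\<close>

text \<open>Turns an asymptotic bound into one for all \<open>n\<close>, as needed where
  \<open>f\<close> is not given by its formula. The finitely many exceptions enter the maximum, and
  the extra 1 makes the constant positive.\<close>

lemma bounded_above_of_eventually:
  fixes g :: "nat \<Rightarrow> real"
  assumes "\<forall>\<^sub>F n in sequentially. g n \<le> C"
  shows "\<exists>C'>0. \<forall>n. g n \<le> C'"
proof -
  obtain N where N: "\<And>n. n \<ge> N \<Longrightarrow> g n \<le> C" using assms by (auto simp: eventually_sequentially)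
  define C' where "C' = Max (insert 1 (insert C (g ` {..<N})))"
  have "1 \<le> C'" unfolding C'_def by (intro Max_ge) auto
  moreover have "g n \<le> C'" for n
  proof (cases "n < N")
    case True then show ?thesis unfolding C'_def by (intro Max_ge) auto
  next
    case False
    then have "g n \<le> C" using N by simp
    also have "\<dots> \<le> C'" unfolding C'_def by (intro Max_ge) auto
    finally show ?thesis .
  qed
  ultimately show ?thesis by (intro exI[of _ C']) auto
qed

text \<open>The minimum with 1 is eventually inactive because \<open>ln (real n) powr b / n\<close>
  tends to 0.\<close>

lemma eventually_tailf_eq:
  assumes "\<exists>r0. \<forall>r::nat \<ge> r0. tailf Rd r = min (ln (real r) powr b / real r) 1"
  shows "\<forall>\<^sub>F n in sequentially. tailf Rd n = ln (real n) powr b / real n"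
proof -
  have "((\<lambda>n. ln (real n) powr b / n) \<longlongrightarrow> 0) sequentially" by real_asymp
  then have "\<forall>\<^sub>F n in sequentially. ln (real n) powr b / n < 1"
    by (rule order_tendstoD) simp
  moreover have "\<forall>\<^sub>F n in sequentially. tailf Rd n = min (ln (real n) powr b / real n) 1"
    using assms by (auto simp: eventually_sequentially)
  ultimately show ?thesis by eventually_elim auto
qed

lemma tendsto_tailf:
  assumes f: "\<forall>\<^sub>F n in sequentially. tailf Rd n = ln (real n) powr b / real n"
  shows "tailf Rd \<longlonglongrightarrow> 0"
proof -
  have "((\<lambda>n. ln (real n) powr b / n) \<longlongrightarrow> 0) sequentially" by real_asymp
  then show ?thesis
    by (rule Lim_transform_eventually) (use f in eventually_elim, simp)
qed

text \<open>The formula gives positivity far out, and monotonicity of the tail carries it back to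
  every \<open>n\<close>.\<close>

lemma tailf_pos:
  assumes f: "\<forall>\<^sub>F n in sequentially. tailf Rd n = ln (real n) powr b / real n"
  shows "tailf Rd n > 0"
proof -
  obtain N where N: "\<And>n. n \<ge> N \<Longrightarrow> tailf Rd n = ln (real n) powr b / real n"
    using f by (auto simp: eventually_sequentially)
  \<comment> \<open>The shift by 2 keeps the logarithm away from 0, where \<open>powr\<close> would
    be 0.\<close>
  have "0 < ln (real (N + n + 2)) powr b / real (N + n + 2)" by simp
  also have "\<dots> = tailf Rd (N + n + 2)" using N[of "N + n + 2"] by simp
  also have "\<dots> \<le> tailf Rd n" by (rule tailf_antimono) simp
  finally show ?thesis .
qed

text \<open>Mean value theorem for \<open>ln x powr (b + 1)\<close> between \<open>r + 1\<close> and
  \<open>r + 2\<close>. For \<open>b \<le> 0\<close> the function \<open>ln x powr b / x\<close> is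
  decreasing, so its value at the intermediate point dominates that at the right end.\<close>

lemma log_power_increment:
  fixes b :: real
  assumes b: "-1 < b" "b \<le> 0" and r: "r \<ge> 1"
  shows "ln (real r + 2) powr b / (real r + 2)
    \<le> (ln (real r + 2) powr (b + 1) - ln (real r + 1) powr (b + 1)) / (b + 1)"
proof -
  have "\<exists>z>real r + 1. z < real r + 2 \<and> ln (real r + 2) powr (b + 1) - ln (real r + 1) powr (b + 1)
       = ((real r + 2) - (real r + 1)) * ((b + 1) * ln z powr b / z)"
  proof (rule MVT2)
    fix x assume x: "real r + 1 \<le> x" "x \<le> real r + 2"
    then have "x > 1" using r by simp
    then show "DERIV (\<lambda>x. ln x powr (b + 1)) x :> (b + 1) * ln x powr b / x"
      by (auto intro!: derivative_eq_intros simp: powr_diff field_simps)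
  qed simp
  then obtain z where z: "real r + 1 < z" "z < real r + 2"
    and eq: "ln (real r + 2) powr (b + 1) - ln (real r + 1) powr (b + 1) = (b + 1) * ln z powr b / z"
    by auto
  have "ln (real r + 2) powr b \<le> ln z powr b"
    using z b r by (intro powr_mono2') auto
  then have "ln (real r + 2) powr b / (real r + 2) \<le> ln z powr b / z"
    using z by (intro frac_le) auto
  then show ?thesis using eq b by simp
qed

text \<open>For \<open>b > 0\<close> the power is increasing and is replaced by its value at
  \<open>n\<close>, while \<open>1 / (r + 2)\<close> is bounded by an increment of the logarithm.
  For \<open>b \<le> 0\<close> the increments of \<open>ln powr (b + 1)\<close> telescope instead,
  and division by \<open>b + 1\<close> is where \<open>b > -1\<close> enters. The shift by 2 keeps
  all logarithms positive, including at \<open>d = 0\<close>.\<close>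

lemma sum_log_power_le:
  fixes b :: real
  assumes b: "-1 < b" and d: "d \<le> n"
  shows "(\<Sum>r = Suc d..n. ln (real r + 2) powr b / (real r + 2))
    \<le> max 1 (1 / (b + 1)) * (ln (real n + 2) powr b * ln ((real n + 2) / (real d + 2)))"
proof -
  let ?l = "\<lambda>r::nat. ln (real r + 2)"
  have l: "0 < ?l r" for r by simp
  have ratio: "ln ((real n + 2) / (real d + 2)) = ?l n - ?l d" by (simp add: ln_div)
  have nonneg: "0 \<le> ?l n powr b * (?l n - ?l d)" using d by (intro mult_nonneg_nonneg) auto
  have mx: "?l n powr b * (?l n - ?l d) * a \<le> max 1 (1 / (b + 1)) * (?l n powr b * (?l n - ?l d))"
    if "a = 1 \<or> a = 1 / (b + 1)" for a
    using nonneg that by (subst mult.commute, intro mult_right_mono) auto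
  show ?thesis
  proof (cases "b \<le> 0")
    case False
    have "(\<Sum>r = Suc d..n. ?l r powr b / (real r + 2)) \<le> (\<Sum>r = Suc d..n. ?l n powr b * (?l r - ?l (r - 1)))"
    proof (rule sum_mono)
      fix r assume r: "r \<in> {Suc d..n}"
      have "ln ((real (r - 1) + 2) / (real r + 2)) \<le> (real (r - 1) + 2) / (real r + 2) - 1"
        by (rule ln_le_minus_one) simp
      also have "\<dots> = - (1 / (real r + 2))" using r by (simp add: field_simps)
      finally have "1 / (real r + 2) \<le> ?l r - ?l (r - 1)" by (simp add: ln_div)
      moreover have "?l r powr b \<le> ?l n powr b" using r False by (intro powr_mono2) auto
      ultimately show "?l r powr b / (real r + 2) \<le> ?l n powr b * (?l r - ?l (r - 1))"
        using mult_mono[of "?l r powr b" "?l n powr b" "1 / (real r + 2)" "?l r - ?l (r - 1)"] by simp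
    qed
    also have "\<dots> = ?l n powr b * (\<Sum>r = Suc d..n. ?l r - ?l (r - 1))" by (simp add: sum_distrib_left)
    also have "(\<Sum>r = Suc d..n. ?l r - ?l (r - 1)) = ?l n - ?l d"
      using d by (rule sum_telescope'')
    also have "?l n powr b * (?l n - ?l d) \<le> max 1 (1 / (b + 1)) * (?l n powr b * (?l n - ?l d))"
      using mx[of 1] by (simp only: mult_1_right simp_thms)
    finally show ?thesis using ratio by simp
  next
    case True
    let ?G = "\<lambda>r. ?l r powr (b + 1) / (b + 1)"
    have "(\<Sum>r = Suc d..n. ?l r powr b / (real r + 2)) \<le> (\<Sum>r = Suc d..n. ?G r - ?G (r - 1))"
    proof (rule sum_mono)
      fix r assume "r \<in> {Suc d..n}"
      then have "r \<ge> 1" "real (r - 1) + 2 = real r + 1" by auto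
      then show "?l r powr b / (real r + 2) \<le> ?G r - ?G (r - 1)"
        using log_power_increment[OF b True, of r] by (simp add: diff_divide_distrib add.commute)
    qed
    also have "\<dots> = ?G n - ?G d" using d by (rule sum_telescope'')
    also have "\<dots> \<le> ?l n powr b * (?l n - ?l d) * (1 / (b + 1))"
    proof -
      \<comment> \<open>A decreasing power allows \<open>?l n powr b\<close> to be factored out of
        the difference of the two powers with exponent \<open>b + 1\<close>.\<close>
      have "?l d powr b \<ge> ?l n powr b" using d True by (intro powr_mono2') auto
      then have "?l n powr b * ?l d \<le> ?l d powr b * ?l d" using l[of d] by (intro mult_right_mono) auto
      then have "?l n powr (b + 1) - ?l d powr (b + 1) \<le> ?l n powr b * (?l n - ?l d)"
        using l[of n] l[of d] by (simp add: powr_add right_diff_distrib)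
      then have "(?l n powr (b + 1) - ?l d powr (b + 1)) / (b + 1) \<le> ?l n powr b * (?l n - ?l d) / (b + 1)"
        using b by (intro divide_right_mono) auto
      then show ?thesis by (simp add: diff_divide_distrib)
    qed
    also have "\<dots> \<le> max 1 (1 / (b + 1)) * (?l n powr b * (?l n - ?l d))" by (rule mx) simp
    finally show ?thesis using ratio by simp
  qed
qed

text \<open>The uniformity in \<open>d\<close> is the point: for nearby points the logarithm is
  large, for distant ones small, and this is what makes the pair correlations summable.\<close>

lemma tail_sum_upper:
  assumes b: "-1 < b"
    and f: "\<forall>\<^sub>F n in sequentially. tailf Rd n = ln (real n) powr b / real n"
  shows "\<exists>K>0. \<forall>\<^sub>F n in sequentially. \<forall>d\<le>n.
     tail_sum Rd n d \<le> K * (n * tailf Rd n) * ln ((real n + 2) / (real d + 2))"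
proof -
  let ?g = "\<lambda>r::nat. ln (real r + 2) powr b / (real r + 2)"
  \<comment> \<open>The shifted function \<open>?g\<close> is positive everywhere and asymptotic to
    \<open>f\<close>, so \<open>f\<close> is at most a constant times \<open>?g\<close> for all
    arguments, also the small ones.\<close>
  have "((\<lambda>n. (ln (real n) powr b / n) * (real n + 2) / (ln (real n + 2) powr b)) \<longlongrightarrow> 1) sequentially"
    by real_asymp
  then have "\<forall>\<^sub>F n in sequentially. (ln (real n) powr b / n) * (real n + 2) / (ln (real n + 2) powr b) < 2"
    by (rule order_tendstoD) simp
  with f have "\<forall>\<^sub>F n in sequentially. tailf Rd n / ?g n \<le> 2"
    by eventually_elim simp
  from bounded_above_of_eventually[OF this] obtain C where C: "C > 0" "\<And>n. tailf Rd n / ?g n \<le> C"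
    by auto
  have fg: "tailf Rd r \<le> C * ?g r" for r
  proof -
    have "?g r > 0" by simp
    then show ?thesis using C(2)[of r] by (simp only: pos_divide_le_eq)
  qed
  let ?m = "max 1 (1 / (b + 1))"
  have "((\<lambda>n. ln (real n + 2) powr b / ln (real n) powr b) \<longlongrightarrow> 1) sequentially" by real_asymp
  then have "\<forall>\<^sub>F n in sequentially. ln (real n + 2) powr b / ln (real n) powr b < 2"
    by (rule order_tendstoD) simp
  with f have "\<forall>\<^sub>F n in sequentially. \<forall>d\<le>n.
     tail_sum Rd n d \<le> (C * ?m * 2) * (n * tailf Rd n) * ln ((real n + 2) / (real d + 2))"
    using eventually_ge_at_top[of 2]
  proof eventually_elim
    case (elim n)
    have le: "ln (real n + 2) powr b \<le> 2 * (n * tailf Rd n)"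
      using elim by (simp add: field_simps)
    show ?case
    proof (intro allI impI)
      fix d assume d: "d \<le> n"
      have "tail_sum Rd n d \<le> C * (\<Sum>r = Suc d..n. ?g r)"
        unfolding tail_sum_def sum_distrib_left by (intro sum_mono fg)
      also have "\<dots> \<le> C * (?m * (ln (real n + 2) powr b * ln ((real n + 2) / (real d + 2))))"
        using C(1) by (intro mult_left_mono sum_log_power_le[OF b d]) auto
      also have "\<dots> \<le> C * (?m * ((2 * (n * tailf Rd n)) * ln ((real n + 2) / (real d + 2))))"
        using C(1) d le by (intro mult_left_mono mult_right_mono) auto
      finally show "tail_sum Rd n d \<le> (C * ?m * 2) * (n * tailf Rd n) * ln ((real n + 2) / (real d + 2))"
        by (simp only: mult.assoc)
    qed
  qed
  moreover have "C * ?m * 2 > 0" using C(1) by (simp add: less_max_iff_disj)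
  ultimately show ?thesis by blast
qed

lemma tail_sum_ge_1:
  assumes "set_pmf Rd \<subseteq> {1..}" "n > 0"
  shows "tail_sum Rd n 0 \<ge> 1"
proof -
  have "tailf Rd 1 = 1"
    unfolding tailf_def using assms(1) by (subst measure_pmf.prob_eq_1) (auto simp: AE_measure_pmf_iff)
  moreover have "tail_sum Rd n 0 \<ge> sum (tailf Rd) {1}"
    unfolding tail_sum_def using assms(2) by (intro sum_mono2) (auto simp: tailf_nonneg)
  ultimately show ?thesis by simp
qed

text \<open>\<open>n * f n * ln (n + 1)\<close> is asymptotic to \<open>ln n powr (b + 1)\<close>,
  whose increments are at most \<open>(b + 2) * f n\<close> for large \<open>n\<close>; telescoping
  compares it with the tail sum. The logarithm of \<open>n + 1\<close> stays positive at
  \<open>n = 1\<close>.\<close>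

lemma tail_sum_lower:
  assumes b: "-1 < b"
    and f: "\<forall>\<^sub>F n in sequentially. tailf Rd n = ln (real n) powr b / real n"
    and pos: "set_pmf Rd \<subseteq> {1..}"
  shows "\<exists>c>0. \<forall>n>0. c * (n * tailf Rd n) * ln (real n + 1) \<le> tail_sum Rd n 0"
proof -
  let ?H = "\<lambda>n. ln (real n) powr (b + 1)"
  \<comment> \<open>The limit \<open>b + 1\<close> is the derivative of the outer power;
    \<open>b + 2\<close> serves as a constant strictly above it.\<close>
  have "((\<lambda>n. (ln (real n) powr (b + 1) - ln (real n - 1) powr (b + 1)) / (ln (real n) powr b / n)) \<longlongrightarrow> b + 1) sequentially"
    by real_asymp
  then have "\<forall>\<^sub>F n in sequentially. (ln (real n) powr (b + 1) - ln (real n - 1) powr (b + 1)) / (ln (real n) powr b / n) < b + 2"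
    by (rule order_tendstoD) simp
  with f have "\<forall>\<^sub>F n in sequentially. ?H n - ln (real n - 1) powr (b + 1) \<le> (b + 2) * tailf Rd n"
    using eventually_ge_at_top[of 2]
  proof eventually_elim
    case (elim n)
    have "0 < ln (real n) powr b / n" using elim by simp
    with elim have "?H n - ln (real n - 1) powr (b + 1) < (b + 2) * (ln (real n) powr b / n)"
      by (simp only: pos_divide_less_eq)
    then show ?case using elim by simp
  qed
  then obtain N where N: "\<And>n. n \<ge> N \<Longrightarrow> ?H n - ln (real n - 1) powr (b + 1) \<le> (b + 2) * tailf Rd n"
    by (auto simp: eventually_sequentially)
  have sum: "?H n - ?H N \<le> (b + 2) * tail_sum Rd n 0" if n: "n \<ge> N" for n
  proof -
    have "?H n - ?H N = (\<Sum>r = Suc N..n. ?H r - ?H (r - 1))"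
      using n by (rule sum_telescope''[symmetric])
    also have "\<dots> \<le> (\<Sum>r = Suc N..n. (b + 2) * tailf Rd r)"
    proof (rule sum_mono)
      fix r assume "r \<in> {Suc N..n}"
      then show "?H r - ?H (r - 1) \<le> (b + 2) * tailf Rd r"
        using N[of r] by simp
    qed
    also have "\<dots> \<le> (\<Sum>r = Suc 0..n. (b + 2) * tailf Rd r)"
      using b by (intro sum_mono2) (auto simp: tailf_nonneg)
    finally show ?thesis by (simp add: tail_sum_def sum_distrib_left)
  qed
  \<comment> \<open>Divergence of \<open>?H\<close>, again by \<open>b > -1\<close>, absorbs the
    starting value: eventually \<open>?H n \<le> 2 * (?H n - ?H N)\<close>.\<close>
  have "filterlim ?H at_top sequentially" using b by real_asymp
  then have "\<forall>\<^sub>F n in sequentially. ?H n \<ge> 2 * ?H N" by (simp add: filterlim_at_top)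
  moreover have "((\<lambda>n. ln (real n) powr b * ln (real n + 1) / ln (real n) powr (b + 1)) \<longlongrightarrow> 1) sequentially"
    by real_asymp
  then have "\<forall>\<^sub>F n in sequentially. ln (real n) powr b * ln (real n + 1) / ln (real n) powr (b + 1) < 2"
    by (rule order_tendstoD) simp
  ultimately have "\<forall>\<^sub>F n in sequentially. n * tailf Rd n * ln (real n + 1) / tail_sum Rd n 0 \<le> 4 * (b + 2)"
    using f eventually_ge_at_top[of "max N 2"]
  proof eventually_elim
    case (elim n)
    have n: "n \<ge> 2" "n \<ge> N" using elim by auto
    have F: "tail_sum Rd n 0 > 0" using tail_sum_ge_1[OF pos, of n] n by simp
    have "?H n > 0" using n by simp
    with elim have "ln (real n) powr b * ln (real n + 1) \<le> 2 * ?H n"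
      by (simp only: pos_divide_less_eq less_imp_le)
    also have "\<dots> \<le> 4 * ((b + 2) * tail_sum Rd n 0)" using sum[OF n(2)] elim(1) by linarith
    also have "\<dots> = 4 * (b + 2) * tail_sum Rd n 0" by simp
    finally show ?case using F n elim by (simp add: divide_le_eq)
  qed
  from bounded_above_of_eventually[OF this] obtain C
    where C: "C > 0" "\<And>n. n * tailf Rd n * ln (real n + 1) / tail_sum Rd n 0 \<le> C" by auto
  have "(1 / C) * (n * tailf Rd n) * ln (real n + 1) \<le> tail_sum Rd n 0" if "n > 0" for n
  proof -
    have F: "tail_sum Rd n 0 > 0" using tail_sum_ge_1[OF pos that] by simp
    have "n * tailf Rd n * ln (real n + 1) \<le> C * tail_sum Rd n 0"
      using C(2)[of n] F by (simp only: pos_divide_le_eq)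
    then show ?thesis using C(1) by (simp add: divide_le_eq mult.commute)
  qed
  then show ?thesis using C(1) by (intro exI[of _ "1 / C"]) auto
qed

lemma tendsto_tail_sum_div:
  assumes b: "-1 < b"
    and f: "\<forall>\<^sub>F n in sequentially. tailf Rd n = ln (real n) powr b / real n"
  shows "(\<lambda>n. tail_sum Rd n 0 / n) \<longlonglongrightarrow> 0"
proof -
  obtain K where K: "K > 0" "\<forall>\<^sub>F n in sequentially. \<forall>d\<le>n.
     tail_sum Rd n d \<le> K * (n * tailf Rd n) * ln ((real n + 2) / (real d + 2))"
    using tail_sum_upper[OF b f] by blast
  have "(\<lambda>n. K * (ln (real n) powr b / n * ln ((real n + 2) / (real 0 + 2)))) \<longlonglongrightarrow> K * 0"
    by (intro tendsto_mult tendsto_const) real_asymp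
  then have lim: "(\<lambda>n. K * (ln (real n) powr b / n * ln ((real n + 2) / (real 0 + 2)))) \<longlonglongrightarrow> 0" by simp
  show ?thesis
  proof (rule tendsto_sandwich[OF _ _ tendsto_const lim])
    show "\<forall>\<^sub>F n in sequentially. 0 \<le> tail_sum Rd n 0 / n" by (simp add: tail_sum_nonneg)
    show "\<forall>\<^sub>F n in sequentially. tail_sum Rd n 0 / n \<le> K * (ln (real n) powr b / n * ln ((real n + 2) / (real 0 + 2)))"
      using K(2) f eventually_gt_at_top[of 0]
    proof eventually_elim
      case (elim n)
      have "tail_sum Rd n 0 \<le> K * (n * tailf Rd n) * ln ((real n + 2) / (real 0 + 2))"
        using elim(1) by blast
      then have "tail_sum Rd n 0 / n \<le> K * (n * tailf Rd n) * ln ((real n + 2) / (real 0 + 2)) / n"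
        by (rule divide_right_mono) simp
      also have "\<dots> = K * (tailf Rd n * ln ((real n + 2) / (real 0 + 2)))" using elim(3) by simp
      finally show ?case using elim(2) by simp
    qed
  qed
qed

section \<open>Limit laws\<close>

text \<open>The distribution function of \<open>Y\<close> vanishes below 0 and is 1 beyond
  \<open>B\<close>, so the support lies in \<open>{0..B}\<close>. A unit atom below
  \<open>t0\<close> would push the distribution function at \<open>t0\<close> above
  \<open>q\<close>; one at or above \<open>t0\<close> leaves no room for the mass at least
  \<open>\<delta>\<close> that lies below \<open>t0 / 2\<close>.\<close>

lemma compact_nondegenerate_limit:
  fixes \<mu> :: "nat \<Rightarrow> real measure"
  assumes \<mu>: "\<And>k. real_distribution (\<mu> k)" and Y: "real_distribution Y"
    and conv: "weak_conv_m \<mu> Y"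
    and neg: "\<And>x k. x < 0 \<Longrightarrow> cdf (\<mu> k) x = 0"
    and upper: "(\<lambda>k. cdf (\<mu> k) B) \<longlonglongrightarrow> 1"
    and small: "\<And>t. t > 0 \<Longrightarrow> \<exists>\<delta>>0. \<forall>\<^sub>F k in sequentially. \<delta> \<le> cdf (\<mu> k) t"
    and large: "t0 > 0" "q < 1" "\<forall>\<^sub>F k in sequentially. cdf (\<mu> k) t0 \<le> q"
  shows "nondegenerate Y \<and> compact (support_of Y)"
proof -
  interpret Y: real_distribution Y by (rule Y)
  have lim: "(\<lambda>k. cdf (\<mu> k) x) \<longlonglongrightarrow> cdf Y x" if "measure Y {x} = 0" for x
    using conv that Y.isCont_cdf by (auto simp: weak_conv_m_def weak_conv_def)
  \<comment> \<open>Weak convergence speaks only of continuity points of the limit; these are dense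
    because there are countably many atoms.\<close>
  have cont: "\<exists>z. a < z \<and> z < b \<and> measure Y {z} = 0" if "a < b" for a b
  proof -
    have "uncountable {a<..<b}" using that by (simp add: uncountable_open_interval)
    then have "\<not> {a<..<b} \<subseteq> {x. measure Y {x} > 0}"
      using Y.countable_atoms countable_subset by blast
    then obtain z where "z \<in> {a<..<b}" "\<not> measure Y {z} > 0" by blast
    then show ?thesis using measure_nonneg[of Y "{z}"] by (intro exI[of _ z]) auto
  qed
  have Y_neg: "cdf Y x = 0" if x: "x < 0" for x
  proof -
    obtain z where z: "x < z" "z < 0" "measure Y {z} = 0" using cont[OF x] by blast
    have "(\<lambda>k. cdf (\<mu> k) z) \<longlonglongrightarrow> 0" using neg[OF z(2)] by simp
    then have "cdf Y z = 0" using lim[OF z(3)] LIMSEQ_unique by blast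
    then show ?thesis using Y.cdf_nondecreasing[of x z] Y.cdf_nonneg[of x] z(1) by simp
  qed
  have Y_upper: "cdf Y x = 1" if x: "x > B" for x
  proof -
    obtain z where z: "B < z" "z < x" "measure Y {z} = 0" using cont[OF x] by blast
    have "1 \<le> cdf Y z"
    proof (rule LIMSEQ_le[OF upper lim[OF z(3)]])
      have "cdf (\<mu> k) B \<le> cdf (\<mu> k) z" for k
      proof -
        interpret real_distribution "\<mu> k" by (rule \<mu>)
        show ?thesis using z(1) by (intro cdf_nondecreasing) simp
      qed
      then show "\<exists>N. \<forall>n\<ge>N. cdf (\<mu> n) B \<le> cdf (\<mu> n) z" by blast
    qed
    then show ?thesis using Y.cdf_nondecreasing[of z x] Y.cdf_bounded_prob[of x] z(2) by simp
  qed
  have "support_of Y \<subseteq> {0..B}"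
  proof
    fix y assume y: "y \<in> support_of Y"
    have "0 \<le> y"
    proof (rule ccontr)
      assume "\<not> 0 \<le> y"
      then have "measure Y (ball y (- y / 2)) > 0" using y by (auto simp: support_of_def)
      also have "measure Y (ball y (- y / 2)) \<le> measure Y {..y / 2}"
        by (intro Y.finite_measure_mono) (auto simp: dist_real_def)
      also have "\<dots> = 0" using Y_neg[of "y / 2"] \<open>\<not> 0 \<le> y\<close> by (simp add: cdf_def)
      finally show False by simp
    qed
    moreover have "y \<le> B"
    proof (rule ccontr)
      assume "\<not> y \<le> B"
      then have "measure Y (ball y ((y - B) / 2)) > 0" using y by (auto simp: support_of_def)
      also have "measure Y (ball y ((y - B) / 2)) \<le> measure Y (space Y - {..(y + B) / 2})"
        by (intro Y.finite_measure_mono) (auto simp: dist_real_def field_simps abs_if split: if_splits)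
      also have "\<dots> = 1 - measure Y {..(y + B) / 2}" by (rule Y.prob_compl) simp
      also have "\<dots> = 0" using Y_upper[of "(y + B) / 2"] \<open>\<not> y \<le> B\<close> by (simp add: cdf_def)
      finally show False by simp
    qed
    ultimately show "y \<in> {0..B}" by simp
  qed
  then have "bounded (support_of Y)" using bounded_subset bounded_closed_interval by blast
  moreover have "closed (support_of Y)"
  proof -
    have "open (- support_of Y)"
      unfolding open_contains_ball
    proof
      fix y assume "y \<in> - support_of Y"
      then obtain e where e: "e > 0" "\<not> measure Y (ball y e) > 0" by (auto simp: support_of_def)
      have "ball y e \<subseteq> - support_of Y"
      proof (rule subsetI, rule ComplI)
        fix z assume z: "z \<in> ball y e" "z \<in> support_of Y"
        then have "measure Y (ball z (e - dist y z)) > 0" by (auto simp: support_of_def)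
        also have "measure Y (ball z (e - dist y z)) \<le> measure Y (ball y e)"
        proof (rule Y.finite_measure_mono)
          show "ball z (e - dist y z) \<subseteq> ball y e"
          proof
            fix w assume "w \<in> ball z (e - dist y z)"
            then show "w \<in> ball y e" using dist_triangle[of y w z] by simp
          qed
        qed auto
        finally show False using e(2) by simp
      qed
      then show "\<exists>e>0. ball y e \<subseteq> - support_of Y" using e(1) by blast
    qed
    then show ?thesis by (simp add: closed_def)
  qed
  moreover have "nondegenerate Y"
    unfolding nondegenerate_def
  proof
    assume "\<exists>c. measure Y {c} = 1"
    then obtain c where c: "measure Y {c} = 1" by blast
    \<comment> \<open>A unit atom at \<open>c\<close> makes every other point a continuity point, so
      the bounds pass to the limit at \<open>t0\<close> and \<open>t0 / 2\<close> directly.\<close>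
    have away: "measure Y {x} = 0" if "x \<noteq> c" for x
    proof -
      have "measure Y ({x} \<union> {c}) = measure Y {x} + measure Y {c}"
        using that by (intro Y.finite_measure_Union) auto
      moreover have "measure Y ({x} \<union> {c}) \<le> 1" by (rule Y.prob_le_1)
      ultimately show ?thesis using c measure_nonneg[of Y "{x}"] by linarith
    qed
    show False
    proof (cases "c < t0")
      case True
      have "measure Y {c} \<le> cdf Y t0"
        unfolding cdf_def using True by (intro Y.finite_measure_mono) auto
      moreover have "cdf Y t0 \<le> q"
        using True by (intro tendsto_upperbound[OF lim[OF away] large(3)]) auto
      ultimately show False using c large(2) by simp
    next
      case False
      have t: "t0 / 2 < c" "0 < t0 / 2" using False large(1) by auto
      obtain \<delta> where \<delta>: "\<delta> > 0" "\<forall>\<^sub>F k in sequentially. \<delta> \<le> cdf (\<mu> k) (t0 / 2)"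
        using small[OF t(2)] by blast
      have "\<delta> \<le> cdf Y (t0 / 2)"
        using t by (intro tendsto_lowerbound[OF lim[OF away] \<delta>(2)]) auto
      moreover have "measure Y ({..t0 / 2} \<union> {c}) = measure Y {..t0 / 2} + measure Y {c}"
        using t by (intro Y.finite_measure_Union) auto
      moreover have "measure Y ({..t0 / 2} \<union> {c}) \<le> 1" by (rule Y.prob_le_1)
      ultimately show False using c \<delta>(1) by (simp add: cdf_def)
    qed
  qed
  ultimately show ?thesis by (simp add: compact_eq_bounded_closed)
qed

section \<open>The scaled cover time\<close>

text \<open>Uses \<open>1 - p \<le> exp (- p)\<close> and
  \<open>p * k \<ge> M * c * ln (n + 1) - 1\<close>; the lost 1 is the cost of rounding
  \<open>k\<close> down and reappears as the factor \<open>exp 1\<close>.\<close>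

lemma not_covered_bound:
  assumes n: "n > 0" and c: "c \<ge> 0" and f: "tailf Rd n > 0" and M: "M \<ge> 0"
    and lower: "c * (n * tailf Rd n) * ln (real n + 1) \<le> tail_sum Rd n 0"
  shows "real n * (1 - tail_sum Rd n 0 / n) ^ nat \<lfloor>M / tailf Rd n\<rfloor> \<le> exp 1 * (real n + 1) powr (1 - M * c)"
proof -
  define p where "p = tail_sum Rd n 0 / n"
  define k where "k = nat \<lfloor>M / tailf Rd n\<rfloor>"
  have p: "0 \<le> p" "p \<le> 1" using tail_sum_0_le[of Rd n] by (auto simp: p_def tail_sum_nonneg)
  have k: "real k \<ge> M / tailf Rd n - 1" unfolding k_def using M f by linarith
  have pl: "c * tailf Rd n * ln (real n + 1) \<le> p"
    using lower n by (simp add: p_def field_simps)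
  have "M * c * ln (real n + 1) - 1 \<le> p * real k"
  proof -
    have "M * c * ln (real n + 1) = (c * tailf Rd n * ln (real n + 1)) * (M / tailf Rd n)"
      using f by simp
    also have "\<dots> \<le> p * (M / tailf Rd n)" using pl M f by (intro mult_right_mono) auto
    \<comment> \<open>Rounding changes the number of objects by at most 1, hence the exponent by at
      most \<open>p\<close>, which is at most 1.\<close>
    finally have "M * c * ln (real n + 1) - 1 \<le> p * (M / tailf Rd n) - p" using p(2) by linarith
    also have "\<dots> = p * (M / tailf Rd n - 1)" by (simp add: right_diff_distrib)
    also have "\<dots> \<le> p * real k" using k p(1) by (rule mult_left_mono)
    finally show ?thesis .
  qed
  then have pk: "exp (- (p * real k)) \<le> exp (1 - M * c * ln (real n + 1))" by simp
  have "(1 - p) ^ k \<le> exp (- p) ^ k"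
    using p exp_ge_add_one_self[of "- p"] by (intro power_mono) auto
  also have "\<dots> = exp (- (p * real k))" by (simp add: exp_of_nat_mult[symmetric] mult.commute)
  also note pk
  finally have "real n * (1 - p) ^ k \<le> (real n + 1) * exp (1 - M * c * ln (real n + 1))"
    using p by (intro mult_mono) auto
  also have "\<dots> = exp 1 * (real n + 1) powr (1 - M * c)"
    by (simp add: powr_def exp_diff left_diff_distrib exp_minus field_simps exp_add[symmetric])
  finally show ?thesis by (simp add: p_def k_def)
qed

lemma prob_scaled_cover_time_gt:
  assumes n: "n > 0" and c: "c \<ge> 0" and f: "tailf Rd n > 0" and M: "M \<ge> 0"
    and lower: "c * (n * tailf Rd n) * ln (real n + 1) \<le> tail_sum Rd n 0"
  shows "measure (cov_space Rd n) {\<omega>. tailf Rd n * real (cover_time n \<omega>) > M}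
     \<le> exp 1 * (real n + 1) powr (1 - M * c)"
proof -
  interpret C: prob_space "cov_space Rd n" by (rule prob_space_cov[OF n])
  let ?k = "nat \<lfloor>M / tailf Rd n\<rfloor>"
  have [measurable]: "cover_time n \<in> measurable (cov_space Rd n) (count_space UNIV)"
    by (rule measurable_cover_time[OF n])
  have "{\<omega>. tailf Rd n * real (cover_time n \<omega>) > M} \<subseteq> {\<omega>. cover_time n \<omega> > ?k}"
  proof safe
    fix \<omega> assume "M < tailf Rd n * real (cover_time n \<omega>)"
    then have "M / tailf Rd n < real (cover_time n \<omega>)" using f by (simp add: pos_divide_less_eq mult.commute)
    moreover have "real ?k \<le> M / tailf Rd n" using M f by simp
    ultimately show "?k < cover_time n \<omega>" by linarith
  qed
  moreover have "{\<omega>. cover_time n \<omega> > ?k} \<in> sets (cov_space Rd n)" by (rule sets_cov_spaceI) measurable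
  ultimately have "measure (cov_space Rd n) {\<omega>. tailf Rd n * real (cover_time n \<omega>) > M}
      \<le> measure (cov_space Rd n) {\<omega>. cover_time n \<omega> > ?k}" by (rule C.finite_measure_mono)
  also note prob_cover_time_gt[OF n, of Rd ?k]
  also note not_covered_bound[OF assms]
  finally show ?thesis .
qed

lemma tight_cover_time:
  fixes b :: real
  assumes b: "-1 < b"
    and f: "\<forall>\<^sub>F n in sequentially. tailf Rd n = ln (real n) powr b / real n"
    and pos: "set_pmf Rd \<subseteq> {1..}"
  shows "tight (\<lambda>m. distr (cov_space Rd (Suc m)) borel
             (\<lambda>\<omega>. tailf Rd (Suc m) * real (cover_time (Suc m) \<omega>)))"
proof -
  obtain c where c: "c > 0" "\<And>n. n > 0 \<Longrightarrow> c * (n * tailf Rd n) * ln (real n + 1) \<le> tail_sum Rd n 0"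
    using tail_sum_lower[OF b f pos] by blast
  have meas: "(\<lambda>\<omega>. tailf Rd (Suc m) * real (cover_time (Suc m) \<omega>)) \<in> borel_measurable (cov_space Rd (Suc m))" for m
  proof -
    have [measurable]: "cover_time (Suc m) \<in> measurable (cov_space Rd (Suc m)) (count_space UNIV)"
      by (rule measurable_cover_time) simp
    show ?thesis by measurable
  qed
  show ?thesis
    unfolding tight_def
  proof (intro conjI allI impI)
    fix m
    show "real_distribution (distr (cov_space Rd (Suc m)) borel
             (\<lambda>\<omega>. tailf Rd (Suc m) * real (cover_time (Suc m) \<omega>)))"
      using meas by (intro prob_space.real_distribution_distr prob_space_cov) auto
  next
    fix \<epsilon> :: real assume \<epsilon>: "\<epsilon> > 0"
    have "((\<lambda>M. exp 1 * 2 powr (1 - M * c)) \<longlongrightarrow> 0) at_top" using c(1) by real_asymp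
    then have "\<forall>\<^sub>F M in at_top. exp 1 * 2 powr (1 - M * c) < \<epsilon>" using \<epsilon> by (rule order_tendstoD)
    then have "\<forall>\<^sub>F M in at_top. exp 1 * 2 powr (1 - M * c) < \<epsilon> \<and> M \<ge> 1 / c \<and> M \<ge> 0"
      by (intro eventually_conj eventually_ge_at_top)
    then obtain M where M: "exp 1 * 2 powr (1 - M * c) < \<epsilon>" "M \<ge> 1 / c" "M \<ge> 0"
      by (metis (mono_tags, lifting) eventually_at_top_linorder order_refl)
    \<comment> \<open>Tightness concerns every index. A nonpositive exponent makes the bound largest
      at the smallest base \<open>n + 1 = 2\<close>, which gives an estimate uniform in
      \<open>m\<close>.\<close>
    have Mc: "1 \<le> M * c" using M(2) c(1) by (simp add: divide_le_eq)
    have "1 - \<epsilon> < measure (distr (cov_space Rd (Suc m)) borel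
             (\<lambda>\<omega>. tailf Rd (Suc m) * real (cover_time (Suc m) \<omega>))) {-1<..M}" for m
    proof -
      let ?n = "Suc m"
      let ?Z = "\<lambda>\<omega>. tailf Rd ?n * real (cover_time ?n \<omega>)"
      interpret C: prob_space "cov_space Rd ?n" by (rule prob_space_cov) simp
      have fpos: "tailf Rd ?n > 0" by (rule tailf_pos[OF f])
      have S: "{\<omega>. ?Z \<omega> > M} \<in> sets (cov_space Rd ?n)"
        using meas[of m] by (intro sets_cov_spaceI) measurable
      have "measure (cov_space Rd ?n) {\<omega>. ?Z \<omega> > M} \<le> exp 1 * (real ?n + 1) powr (1 - M * c)"
        using c(1) fpos M(3) c(2)[of ?n] by (intro prob_scaled_cover_time_gt) simp_all
      also have "\<dots> \<le> exp 1 * 2 powr (1 - M * c)"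
        using Mc by (intro mult_left_mono powr_mono2') auto
      finally have "measure (cov_space Rd ?n) {\<omega>. ?Z \<omega> > M} < \<epsilon>" using M(1) by linarith
      moreover have "measure (distr (cov_space Rd ?n) borel ?Z) {-1<..M}
          = measure (cov_space Rd ?n) (space (cov_space Rd ?n) - {\<omega>. ?Z \<omega> > M})"
      proof -
        have "?Z \<omega> > -1" for \<omega>
          by (rule less_le_trans[of _ 0]) (auto simp: tailf_nonneg)
        then have "?Z -` {-1<..M} \<inter> space (cov_space Rd ?n) = space (cov_space Rd ?n) - {\<omega>. ?Z \<omega> > M}"
          by auto
        then show ?thesis using meas[of m] by (subst measure_distr) auto
      qed
      ultimately show ?thesis using C.prob_compl[OF S] by simp
    qed
    then show "\<exists>a b. a < b \<and> (\<forall>n. 1 - \<epsilon> < measure (distr (cov_space Rd (Suc n)) borel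
             (\<lambda>\<omega>. tailf Rd (Suc n) * real (cover_time (Suc n) \<omega>))) {a<..b})"
      using M(3) by (intro exI[of _ "-1"] exI[of _ M]) auto
  qed
qed

section \<open>The distribution function of the scaled continuous cover time\<close>

definition scaled_cdf :: "nat pmf \<Rightarrow> nat \<Rightarrow> real \<Rightarrow> real" where
  "scaled_cdf Rd n x = measure (cov_space Rd n) {\<omega>. tailf Rd n * cont_cover_time n \<omega> \<le> x}"

lemma cdf_scaled_cover_time:
  assumes n: "n > 0"
  shows "cdf (distr (cov_space Rd n) borel (\<lambda>\<omega>. tailf Rd n * cont_cover_time n \<omega>)) x = scaled_cdf Rd n x"
proof -
  have [measurable]: "cont_cover_time n \<in> borel_measurable (cov_space Rd n)"
    by (rule measurable_cont_cover_time[OF n])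
  show ?thesis
    unfolding cdf_def scaled_cdf_def
    by (subst measure_distr) (auto intro!: arg_cong[where f = "measure (cov_space Rd n)"])
qed

lemma scaled_cdf_neg:
  assumes n: "n > 0" and x: "x < 0"
  shows "scaled_cdf Rd n x = 0"
proof -
  interpret C: prob_space "cov_space Rd n" by (rule prob_space_cov[OF n])
  have "scaled_cdf Rd n x \<le> measure (cov_space Rd n) {}"
    unfolding scaled_cdf_def
  proof (rule C.finite_measure_mono_AE)
    show "AE \<omega> in cov_space Rd n. \<omega> \<in> {\<omega>. tailf Rd n * cont_cover_time n \<omega> \<le> x} \<longrightarrow> \<omega> \<in> {}"
      using AE_arrival_incr[OF n]
    proof eventually_elim
      case (elim \<omega>)
      have "cont_cover_time n \<omega> \<ge> 0"
        unfolding cont_cover_time_def arrival_def using elim by (intro sum_nonneg) auto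
      then have "tailf Rd n * cont_cover_time n \<omega> \<ge> 0" by (simp add: tailf_nonneg)
      then show ?case using x by auto
    qed
  qed auto
  then show ?thesis by (simp add: scaled_cdf_def measure_le_0_iff)
qed

lemma scaled_cdf_ge:
  assumes n: "n > 0" and f: "tailf Rd n > 0" and M: "M \<ge> 0"
  defines "k \<equiv> nat \<lfloor>M / tailf Rd n\<rfloor>"
  shows "1 - (measure (cov_space Rd n) {\<omega>. covered n \<omega> k \<noteq> {0..<n}} + (2 / exp 1) ^ k) \<le> scaled_cdf Rd n (2 * M)"
proof -
  interpret C: prob_space "cov_space Rd n" by (rule prob_space_cov[OF n])
  have [measurable]: "cont_cover_time n \<in> borel_measurable (cov_space Rd n)"
    by (rule measurable_cont_cover_time[OF n])
  have S: "{\<omega>. tailf Rd n * cont_cover_time n \<omega> \<le> 2 * M} \<in> sets (cov_space Rd n)"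
    by (rule sets_cov_spaceI) measurable
  have "1 - scaled_cdf Rd n (2 * M) = measure (cov_space Rd n) (UNIV - {\<omega>. tailf Rd n * cont_cover_time n \<omega> \<le> 2 * M})"
    using C.prob_compl[OF S] by (simp add: scaled_cdf_def)
  also have "\<dots> \<le> measure (cov_space Rd n) {\<omega>. cont_cover_time n \<omega> > 2 * real k}"
  proof (rule C.finite_measure_mono)
    show "UNIV - {\<omega>. tailf Rd n * cont_cover_time n \<omega> \<le> 2 * M} \<subseteq> {\<omega>. cont_cover_time n \<omega> > 2 * real k}"
    proof safe
      fix \<omega> assume "\<not> tailf Rd n * cont_cover_time n \<omega> \<le> 2 * M"
      then have "2 * (M / tailf Rd n) < cont_cover_time n \<omega>" using f by (simp add: pos_divide_less_eq mult.commute)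
      moreover have "real k \<le> M / tailf Rd n" using M f by (simp add: k_def)
      ultimately show "2 * real k < cont_cover_time n \<omega>" by linarith
    qed
    show "{\<omega>. cont_cover_time n \<omega> > 2 * real k} \<in> sets (cov_space Rd n)"
      by (rule sets_cov_spaceI) measurable
  qed
  also note prob_cont_cover_time_gt[OF n, of Rd k]
  finally show ?thesis by linarith
qed

lemma scaled_cdf_le:
  assumes n: "n > 0" and f: "tailf Rd n > 0" and pos: "tail_sum Rd n 0 > 0" and M: "tailf Rd n \<le> M"
  defines "k \<equiv> nat \<lfloor>M / tailf Rd n\<rfloor>"
  shows "scaled_cdf Rd n (M / 4)
     \<le> 1 - measure (cov_space Rd n) {\<omega>. covered n \<omega> k \<noteq> {0..<n}} + (exp (1/2) / 2) ^ k"
proof -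
  interpret C: prob_space "cov_space Rd n" by (rule prob_space_cov[OF n])
  have [measurable]: "cont_cover_time n \<in> borel_measurable (cov_space Rd n)"
    by (rule measurable_cont_cover_time[OF n])
  \<comment> \<open>Once the floor is at least 1, rounding down loses at most a factor 2; together
    with the factor 2 from early arrivals this explains the argument \<open>M / 4\<close>.\<close>
  have "1 \<le> \<lfloor>M / tailf Rd n\<rfloor>" using M f by simp
  then have k: "M / tailf Rd n \<le> 2 * real k"
    unfolding k_def by linarith
  have "scaled_cdf Rd n (M / 4) \<le> measure (cov_space Rd n) {\<omega>. cont_cover_time n \<omega> \<le> k / 2}"
    unfolding scaled_cdf_def
  proof (rule C.finite_measure_mono)
    show "{\<omega>. tailf Rd n * cont_cover_time n \<omega> \<le> M / 4} \<subseteq> {\<omega>. cont_cover_time n \<omega> \<le> k / 2}"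
    proof safe
      fix \<omega> assume "tailf Rd n * cont_cover_time n \<omega> \<le> M / 4"
      then have "4 * cont_cover_time n \<omega> \<le> M / tailf Rd n" using f by (simp add: field_simps)
      then show "cont_cover_time n \<omega> \<le> k / 2" using k by linarith
    qed
    show "{\<omega>. cont_cover_time n \<omega> \<le> k / 2} \<in> sets (cov_space Rd n)"
      by (rule sets_cov_spaceI) measurable
  qed
  also note prob_cont_cover_time_le[OF n pos, of k]
  finally show ?thesis .
qed

lemma filterlim_scale:
  assumes f: "\<forall>\<^sub>F n in sequentially. tailf Rd n = ln (real n) powr b / real n" and M: "M > 0"
  shows "filterlim (\<lambda>n. nat \<lfloor>M / tailf Rd n\<rfloor>) sequentially sequentially"
proof -
  have "filterlim (\<lambda>n. inverse (tailf Rd n)) at_top sequentially"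
    using tendsto_tailf[OF f] tailf_pos[OF f] by (intro filterlim_inverse_at_top) auto
  then have "filterlim (\<lambda>n. M * inverse (tailf Rd n)) at_top sequentially"
    by (rule filterlim_tendsto_pos_mult_at_top[OF tendsto_const M])
  then show ?thesis
    unfolding divide_inverse
    by (intro filterlim_compose[OF filterlim_nat_sequentially] filterlim_compose[OF filterlim_floor_sequentially])
qed

lemma tendsto_power_scale:
  assumes f: "\<forall>\<^sub>F n in sequentially. tailf Rd n = ln (real n) powr b / real n"
    and M: "M > 0" and x: "0 \<le> x" "x < (1 :: real)"
  shows "(\<lambda>n. x ^ nat \<lfloor>M / tailf Rd n\<rfloor>) \<longlonglongrightarrow> 0"
  using x by (intro filterlim_compose[OF LIMSEQ_power_zero filterlim_scale[OF f M]]) auto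

text \<open>Squaring \<open>exp (1 / 2) \<ge> 3 / 2\<close> gives
  \<open>exp 1 \<ge> 9 / 4\<close>.\<close>

lemma two_less_exp_1: "2 / exp 1 < (1 :: real)"
proof -
  have "3 / 2 * (3 / 2) \<le> exp (1 / 2) * exp (1 / 2 :: real)"
    using exp_ge_add_one_self[of "1 / 2 :: real"] by (intro mult_mono) auto
  then have "2 < exp (1 :: real)" by (simp add: exp_add[symmetric])
  then show ?thesis by simp
qed

lemma scaled_cdf_tendsto_1:
  fixes b :: real
  assumes b: "-1 < b"
    and f: "\<forall>\<^sub>F n in sequentially. tailf Rd n = ln (real n) powr b / real n"
    and pos: "set_pmf Rd \<subseteq> {1..}"
  shows "\<exists>B. (\<lambda>n. scaled_cdf Rd n B) \<longlonglongrightarrow> 1"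
proof -
  obtain c where c: "c > 0" "\<And>n. n > 0 \<Longrightarrow> c * (n * tailf Rd n) * ln (real n + 1) \<le> tail_sum Rd n 0"
    using tail_sum_lower[OF b f pos] by blast
  \<comment> \<open>This choice makes the exponent \<open>1 - M * c\<close> equal to -1, so the
    union bound tends to 0.\<close>
  define M where "M = 2 / c"
  have M: "M > 0" "M * c = 2" using c(1) by (auto simp: M_def)
  let ?e = "\<lambda>n. exp 1 * (real n + 1) powr (1 - M * c) + (2 / exp 1) ^ nat \<lfloor>M / tailf Rd n\<rfloor>"
  have "?e \<longlonglongrightarrow> exp 1 * 0 + 0"
    using M two_less_exp_1
    by (intro tendsto_add tendsto_mult tendsto_const tendsto_power_scale[OF f]) (simp_all, real_asymp)
  then have "(\<lambda>n. 1 - ?e n) \<longlonglongrightarrow> 1 - (exp 1 * 0 + 0)" by (intro tendsto_diff tendsto_const)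
  then have lim: "(\<lambda>n. 1 - ?e n) \<longlonglongrightarrow> 1" by simp
  have "(\<lambda>n. scaled_cdf Rd n (2 * M)) \<longlonglongrightarrow> 1"
  proof (rule tendsto_sandwich[OF _ _ lim tendsto_const])
    show "\<forall>\<^sub>F n in sequentially. 1 - ?e n \<le> scaled_cdf Rd n (2 * M)"
      using eventually_gt_at_top[of 0]
    proof eventually_elim
      case (elim n)
      note tp = tailf_pos[OF f, of n]
      have "real n * (1 - tail_sum Rd n 0 / n) ^ nat \<lfloor>M / tailf Rd n\<rfloor> \<le> exp 1 * (real n + 1) powr (1 - M * c)"
        by (rule not_covered_bound[OF elim _ tp _ c(2)[OF elim]]) (use c M in auto)
      then show ?case
        using scaled_cdf_ge[OF elim tp, of M] prob_not_covered_le[OF elim, of Rd "nat \<lfloor>M / tailf Rd n\<rfloor>"] M(1)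
        by linarith
    qed
    show "\<forall>\<^sub>F n in sequentially. scaled_cdf Rd n (2 * M) \<le> 1"
      using eventually_gt_at_top[of 0]
      by eventually_elim (simp add: scaled_cdf_def prob_space.prob_le_1[OF prob_space_cov])
  qed
  then show ?thesis by blast
qed

text \<open>Within \<open>M / f n\<close> objects, one of radius at least \<open>n\<close> is absent
  with probability at most \<open>exp (f n - M)\<close>, which tends to
  \<open>exp (- M) < 1\<close>.\<close>

lemma scaled_cdf_eventually_ge:
  fixes b :: real
  assumes f: "\<forall>\<^sub>F n in sequentially. tailf Rd n = ln (real n) powr b / real n"
    and t: "t > 0"
  shows "\<exists>\<delta>>0. \<forall>\<^sub>F n in sequentially. \<delta> \<le> scaled_cdf Rd n t"
proof -
  define M where "M = t / 2"
  have M: "M > 0" "2 * M = t" using t by (auto simp: M_def)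
  let ?e = "\<lambda>n. exp (tailf Rd n - M) + (2 / exp 1) ^ nat \<lfloor>M / tailf Rd n\<rfloor>"
  \<comment> \<open>Half of the limiting gap \<open>1 - exp (- M)\<close>, so that the strict
    inequality survives for large \<open>n\<close>.\<close>
  define \<delta> where "\<delta> = (1 - exp (- M)) / 2"
  have \<delta>: "\<delta> > 0" using M(1) by (simp add: \<delta>_def)
  have "?e \<longlonglongrightarrow> exp (0 - M) + 0"
    using M two_less_exp_1
    by (intro tendsto_add tendsto_exp tendsto_diff tendsto_const tendsto_tailf[OF f] tendsto_power_scale[OF f]) auto
  moreover have "exp (0 - M) + 0 < 1 - \<delta>" using \<delta> by (simp add: \<delta>_def field_simps)
  ultimately have "\<forall>\<^sub>F n in sequentially. ?e n < 1 - \<delta>" by (rule order_tendstoD)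
  then have "\<forall>\<^sub>F n in sequentially. \<delta> \<le> scaled_cdf Rd n t"
    using eventually_gt_at_top[of 0]
  proof eventually_elim
    case (elim n)
    let ?k = "nat \<lfloor>M / tailf Rd n\<rfloor>"
    note tp = tailf_pos[OF f, of n]
    have "M / tailf Rd n - 1 \<le> real ?k" using M tp by linarith
    then have "tailf Rd n * (M / tailf Rd n - 1) \<le> tailf Rd n * real ?k"
      using tp by (intro mult_left_mono) auto
    then have k: "- (tailf Rd n * real ?k) \<le> tailf Rd n - M"
      using tp by (simp add: right_diff_distrib)
    have "(1 - tailf Rd n) ^ ?k \<le> exp (- tailf Rd n) ^ ?k"
      using tailf_le_1[of Rd n] exp_ge_add_one_self[of "- tailf Rd n"] by (intro power_mono) auto
    also have "\<dots> = exp (- (tailf Rd n * real ?k))"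
      by (simp add: exp_of_nat_mult[symmetric] mult.commute)
    also have "\<dots> \<le> exp (tailf Rd n - M)" using k by simp
    finally show ?case
      using scaled_cdf_ge[OF elim(2) tp, of M] prob_not_covered_le_tailf[OF elim(2), of Rd ?k] M elim(1)
      by simp
  qed
  then show ?thesis using \<delta> by blast
qed

lemma scaled_cdf_eventually_le:
  fixes b :: real
  assumes b: "-1 < b"
    and f: "\<forall>\<^sub>F n in sequentially. tailf Rd n = ln (real n) powr b / real n"
    and pos: "set_pmf Rd \<subseteq> {1..}"
  shows "\<exists>t>0. \<forall>\<^sub>F n in sequentially. scaled_cdf Rd n t \<le> 11 / 12"
proof -
  obtain K where K: "K > 0" "\<forall>\<^sub>F n in sequentially. \<forall>d\<le>n.
     tail_sum Rd n d \<le> K * (n * tailf Rd n) * ln ((real n + 2) / (real d + 2))"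
    using tail_sum_upper[OF b f] by blast
  \<comment> \<open>Chosen so that \<open>8 * K * M = 1 / 2\<close>, the coefficient that
    \<open>prob_not_covered_ge\<close> allows in front of the logarithm.\<close>
  define M where "M = 1 / (16 * K)"
  have M: "M > 0" "16 * K * M = 1" using K(1) by (auto simp: M_def)
  have sqrt_e: "exp (1/2) / 2 < (1 :: real)"
  proof -
    have "exp (1/2 :: real) ^ 2 < 2 ^ 2"
      using exp_le by (simp add: exp_of_nat_mult[symmetric])
    then have "exp (1/2 :: real) < 2" by (rule power_less_imp_less_base) simp
    then show ?thesis by simp
  qed
  have "\<forall>\<^sub>F n in sequentially. tailf Rd n < M"
    by (rule order_tendstoD(2)[OF tendsto_tailf[OF f] M(1)])
  moreover have "\<forall>\<^sub>F n in sequentially. tail_sum Rd n 0 / n < 1 / 2"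
    by (rule order_tendstoD(2)[OF tendsto_tail_sum_div[OF b f]]) simp
  moreover have "\<forall>\<^sub>F n in sequentially. (exp (1/2) / 2) ^ nat \<lfloor>M / tailf Rd n\<rfloor> < (1 / 12 :: real)"
    by (rule order_tendstoD(2)[OF tendsto_power_scale[OF f M(1) _ sqrt_e]]) auto
  ultimately have "\<forall>\<^sub>F n in sequentially. scaled_cdf Rd n (M / 4) \<le> 11 / 12"
    using K(2) eventually_gt_at_top[of 0]
  proof eventually_elim
    case (elim n)
    let ?k = "nat \<lfloor>M / tailf Rd n\<rfloor>"
    have n: "n > 0" by fact
    have F: "tail_sum Rd n 0 > 0" using tail_sum_ge_1[OF pos n] by simp
    note tp = tailf_pos[OF f, of n]
    have k: "real ?k * tailf Rd n \<le> M" using M tp by (simp add: pos_le_divide_eq[symmetric])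
    have "1 / 6 \<le> measure (cov_space Rd n) {\<omega>. covered n \<omega> ?k \<noteq> {0..<n}}"
    proof (rule prob_not_covered_ge[OF n])
      show "tail_sum Rd n 0 / n \<le> 1 / 2" using elim by simp
      fix d assume d: "d \<le> n"
      let ?l = "ln ((real n + 2) / (real d + 2))"
      have l: "0 \<le> ?l" using d by simp
      have "8 * real ?k * tail_sum Rd n d / n \<le> 8 * real ?k * (K * (n * tailf Rd n) * ?l) / n"
        using elim d by (intro divide_right_mono mult_left_mono) auto
      also have "\<dots> = 8 * K * (real ?k * tailf Rd n) * ?l" using n by simp
      also have "\<dots> \<le> 8 * K * M * ?l"
        using k l K(1) by (intro mult_right_mono mult_left_mono) auto
      also have "\<dots> = ?l / 2" using K(1) by (simp add: M_def)
      finally show "8 * real ?k * tail_sum Rd n d / n \<le> ?l / 2" .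
    qed
    \<comment> \<open>The bound \<open>11 / 12\<close> is \<open>1 - 1 / 6 + 1 / 12\<close>, where
      \<open>1 / 12\<close> dominates the probability of an early arrival.\<close>
    then show ?case
      using scaled_cdf_le[OF n tp F, of M] elim by linarith
  qed
  then show ?thesis using M(1) by (intro exI[of _ "M / 4"]) auto
qed

text \<open>The three estimates for \<open>scaled_cdf\<close> hold along the full sequence and are
  inherited by every subsequence, so the criterion applies to any subsequential limit.\<close>

lemma limit_cont_cover_time:
  fixes s :: "nat \<Rightarrow> nat" and b :: real
  assumes b: "-1 < b"
    and f: "\<forall>\<^sub>F n in sequentially. tailf Rd n = ln (real n) powr b / real n"
    and pos: "set_pmf Rd \<subseteq> {1..}"
    and s: "strict_mono s" "\<And>k. s k \<ge> 1" and Y: "real_distribution Y"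
    and conv: "weak_conv_m (\<lambda>k. distr (cov_space Rd (s k)) borel
                 (\<lambda>\<omega>. tailf Rd (s k) * cont_cover_time (s k) \<omega>)) Y"
  shows "nondegenerate Y \<and> compact (support_of Y)"
proof -
  have sk: "s k > 0" for k using s(2)[of k] by simp
  note sub = filterlim_subseq[OF s(1)]
  obtain B where B: "(\<lambda>n. scaled_cdf Rd n B) \<longlonglongrightarrow> 1"
    using scaled_cdf_tendsto_1[OF b f pos] by blast
  obtain t0 where t0: "t0 > 0" "\<forall>\<^sub>F n in sequentially. scaled_cdf Rd n t0 \<le> 11 / 12"
    using scaled_cdf_eventually_le[OF b f pos] by blast
  show ?thesis
  proof (rule compact_nondegenerate_limit[OF _ Y conv, unfolded cdf_scaled_cover_time[OF sk]])
    show "real_distribution (distr (cov_space Rd (s k)) borel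
        (\<lambda>\<omega>. tailf Rd (s k) * cont_cover_time (s k) \<omega>))" for k
      using measurable_cont_cover_time[OF sk[of k], of Rd]
      by (intro prob_space.real_distribution_distr prob_space_cov sk) auto
    show "scaled_cdf Rd (s k) x = 0" if "x < 0" for x k
      by (rule scaled_cdf_neg[OF sk that])
    show "(\<lambda>k. scaled_cdf Rd (s k) B) \<longlonglongrightarrow> 1"
      by (rule filterlim_compose[OF B sub])
    show "\<exists>\<delta>>0. \<forall>\<^sub>F k in sequentially. \<delta> \<le> scaled_cdf Rd (s k) t" if "t > 0" for t
    proof -
      obtain \<delta> where "\<delta> > 0" "\<forall>\<^sub>F n in sequentially. \<delta> \<le> scaled_cdf Rd n t"
        using scaled_cdf_eventually_ge[OF f \<open>t > 0\<close>] by blast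
      then show ?thesis using eventually_compose_filterlim[OF _ sub] by blast
    qed
    show "\<forall>\<^sub>F k in sequentially. scaled_cdf Rd (s k) t0 \<le> 11 / 12"
      by (rule eventually_compose_filterlim[OF t0(2) sub])
  qed (use t0(1) in auto)
qed

text \<open>The tail formula is assumed for large \<open>r\<close> only: at \<open>r = 1\<close> the
  value \<open>0 powr b = 0\<close> would contradict \<open>tailf Rd 1 = 1\<close>. Indexing by
  \<open>Suc m\<close> starts the sequence at the torus with one point.\<close>

theorem theoremB:
  fixes Rd :: "nat pmf" and b :: real
  assumes b: "b > -1"
    and R_pos: "set_pmf Rd \<subseteq> {1..}"
    and f_form: "\<exists>r0. \<forall>r::nat \<ge> r0. tailf Rd r = min (ln (real r) powr b / real r) 1"
  shows "tight (\<lambda>m. distr (cov_space Rd (Suc m)) borel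
             (\<lambda>\<omega>. tailf Rd (Suc m) * real (cover_time (Suc m) \<omega>)))
       \<and> (\<forall>(s :: nat \<Rightarrow> nat) (Y :: real measure).
           strict_mono s \<and> (\<forall>k. s k \<ge> 1) \<and> real_distribution Y \<and>
           weak_conv_m (\<lambda>k. distr (cov_space Rd (s k)) borel
                             (\<lambda>\<omega>. tailf Rd (s k) * cont_cover_time (s k) \<omega>)) Y
           \<longrightarrow> nondegenerate Y \<and> compact (support_of Y))"
  using tight_cover_time[OF b eventually_tailf_eq[OF f_form] R_pos]
    limit_cont_cover_time[OF b eventually_tailf_eq[OF f_form] R_pos]
  by blast

end
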